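(* Let $\mathbf{k}$ be a field of characteristic zero and let $S$ be a pointed saturated affine semigroup, minimally embedded in a free abelian group $M$ of rank $n$. The natural map $$\pi\colon \operatorname{Der}_I(\mathbf{k}[S])\to \operatorname{Der}(\mathbf{k}[S]/I)$$ is surjective for every monomial ideal $I\subset\mathbf{k}[S]$ if and only if $S\cong\mathbb{Z}^n_{\geq 0}$ as semigroups.
   Context: An affine semigroup $S$ is a finitely generated commutative semigroup with identity that can be embedded in a lattice. It is minimally embedded in $M\cong\mathbb{Z}^n$ if no proper sublattice of $M$ contains $S$ (i.e. $S$ generates $M$ as a group). Let $\omega_S\subset M_{\mathbb{R}}=M\otimes\mathbb{R}$ be the cone spanned by $S$. $S$ is saturated if $\omega_S\cap M=S$, and pointed if the only vector space contained in $\omega_S$ is $\{0\}$. The semigroup algebra is $\mathbf{k}[S]=\bigoplus_{m\in S}\mathbf{k}\cdot\mathbf{x}^m$ with $\mathbf{x}^m\cdot\mathbf{x}^{m'}=\mathbf{x}^{m+m'}$, $\mathbf{x}^0=1$. The $\mathbf{x}^m$ are called monomials; a monomial ideal is an ideal generated by finitely many monomials. For a $\mathbf{k}$-algebra $B$, $\operatorname{Der}(B)$ is the $\mathbf{k}$-vector space of $\mathbf{k}$-derivations $B\to B$; for an ideal $I\subset B$, $\operatorname{Der}_I(B)=\{\partial\in\operatorname{Der}(B)\mid \partial(I)\subset I\}$. The natural map $\pi$ sends $\partial$ to $\overline{\partial}$ defined by $\overline{\partial}(\overline{a})=\overline{\partial(a)}$, where a bar on an element denotes its class modulo $I$. *)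

theory Defs
  imports
    "HOL-Analysis.Analysis"
    "HOL-Analysis.Finite_Function_Topology"
    "HOL-Algebra.QuotRing"
    "HOL-Algebra.Module"
    "HOL-Algebra.Free_Abelian_Groups"
begin

section \<open>Affine semigroups\<close>

definition add_monoid_on :: "'a::comm_monoid_add set \<Rightarrow> 'a monoid" where
  "add_monoid_on A = \<lparr>carrier = A, monoid.mult = (+), one = 0\<rparr>"

text \<open>
  The lattice \<open>M\<close> is the whole type \<open>'m\<close>, and semigroups are subsets of it. An isomorphism
  \<open>h\<close> from \<open>M\<close> onto \<open>free_Abelian_group {..<n}\<close>, i.e. onto the integer vectors supported on
  \<open>{..<n}\<close>, expresses that \<open>M\<close> is free abelian of rank \<open>n\<close>; rank \<open>0\<close> is included.
  Such an \<open>h\<close> also identifies \<open>M \<otimes> \<real>\<close> with the real vectors supported on \<open>{..<n}\<close>, and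
  \<open>real_point h\<close> is then the canonical map from \<open>M\<close> to \<open>M \<otimes> \<real>\<close>. Another choice of \<open>h\<close>
  changes this only by a linear automorphism, which affects neither \<open>saturated\<close> nor \<open>pointed\<close>.
\<close>

definition affine_semigroup :: "'m::ab_group_add set \<Rightarrow> bool" where
  "affine_semigroup S \<longleftrightarrow>
     submonoid S (add_monoid_on UNIV) \<and>
     (\<exists>F. finite F \<and> S = (\<lambda>T. submonoid T (add_monoid_on UNIV)) hull F)"

definition minimally_embedded :: "'m::ab_group_add set \<Rightarrow> bool" where
  "minimally_embedded S \<longleftrightarrow>
     (\<forall>L. subgroup L (add_monoid_on UNIV) \<and> S \<subseteq> L \<longrightarrow> L = UNIV)"

definition real_point :: "('m \<Rightarrow> (nat \<Rightarrow>\<^sub>0 int)) \<Rightarrow> 'm \<Rightarrow> (nat \<Rightarrow>\<^sub>0 real)" where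
  "real_point h m = Poly_Mapping.map real_of_int (h m)"

definition spanned_cone :: "('m \<Rightarrow> (nat \<Rightarrow>\<^sub>0 int)) \<Rightarrow> 'm set \<Rightarrow> (nat \<Rightarrow>\<^sub>0 real) set" where
  "spanned_cone h S = convex_cone hull (real_point h ` S)"

definition saturated :: "('m \<Rightarrow> (nat \<Rightarrow>\<^sub>0 int)) \<Rightarrow> 'm set \<Rightarrow> bool" where
  "saturated h S \<longleftrightarrow> {m. real_point h m \<in> spanned_cone h S} = S"

definition pointed :: "('m \<Rightarrow> (nat \<Rightarrow>\<^sub>0 int)) \<Rightarrow> 'm set \<Rightarrow> bool" where
  "pointed h S \<longleftrightarrow> (\<forall>V. subspace V \<and> V \<subseteq> spanned_cone h S \<longrightarrow> V = {0})"

definition nonneg_orthant :: "nat \<Rightarrow> (nat \<Rightarrow>\<^sub>0 int) set" where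
  "nonneg_orthant n =
     {v \<in> carrier (free_Abelian_group {..<n}). \<forall>i. 0 \<le> Poly_Mapping.lookup v i}"


section \<open>Semigroup algebras and monomial ideals\<close>

definition semigroup_algebra :: "'m::comm_monoid_add set \<Rightarrow> ('k::field, 'm \<Rightarrow>\<^sub>0 'k) module" where
  "semigroup_algebra S =
     \<lparr>carrier = {p. Poly_Mapping.keys p \<subseteq> S}, monoid.mult = (*), one = 1, ring.zero = 0, ring.add = (+),
      smult = (\<lambda>c p. Poly_Mapping.single 0 c * p)\<rparr>"

definition monomial :: "'m \<Rightarrow> ('m \<Rightarrow>\<^sub>0 'k::field)" where
  "monomial m = Poly_Mapping.single m 1"

definition monomial_ideal :: "'m::comm_monoid_add set \<Rightarrow> ('m \<Rightarrow>\<^sub>0 'k::field) set \<Rightarrow> bool" where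
  "monomial_ideal S I \<longleftrightarrow>
     (\<exists>F. finite F \<and> F \<subseteq> S \<and> I = genideal (semigroup_algebra S) (monomial ` F))"


section \<open>Derivations\<close>

text \<open>
  Algebras are records of type \<open>module\<close> in which every element of the scalar type acts.
  Derivations are extensional (\<open>undefined\<close> outside the carrier), so that equality of
  derivations is equality of functions on the carrier.
\<close>

definition Der :: "('k, 'a, 'z) module_scheme \<Rightarrow> ('a \<Rightarrow> 'a) set" where
  "Der B = {d \<in> carrier B \<rightarrow>\<^sub>E carrier B.
     (\<forall>x\<in>carrier B. \<forall>y\<in>carrier B. d (x \<oplus>\<^bsub>B\<^esub> y) = d x \<oplus>\<^bsub>B\<^esub> d y) \<and>
     (\<forall>c. \<forall>x\<in>carrier B. d (c \<odot>\<^bsub>B\<^esub> x) = c \<odot>\<^bsub>B\<^esub> d x) \<and>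
     (\<forall>x\<in>carrier B. \<forall>y\<in>carrier B.
        d (x \<otimes>\<^bsub>B\<^esub> y) = (x \<otimes>\<^bsub>B\<^esub> d y) \<oplus>\<^bsub>B\<^esub> (d x \<otimes>\<^bsub>B\<^esub> y))}"

definition Der_ideal :: "('k, 'a, 'z) module_scheme \<Rightarrow> 'a set \<Rightarrow> ('a \<Rightarrow> 'a) set" where
  "Der_ideal B I = {d \<in> Der B. d ` I \<subseteq> I}"

text \<open>
  In the next two definitions, the union over the representatives \<open>x\<close> of a class \<open>X\<close> is a
  union of equal cosets whenever the operation is well defined on classes, and hence is that
  common coset.
\<close>

definition quotient_algebra :: "('k, 'a, 'z) module_scheme \<Rightarrow> 'a set \<Rightarrow> ('k, 'a set) module" where
  "quotient_algebra B I =
     ring.extend (B Quot I) (module.fields (\<lambda>c X. \<Union>x\<in>X. I +>\<^bsub>B\<^esub> (c \<odot>\<^bsub>B\<^esub> x)))"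

definition induced_map ::
    "('k, 'a, 'z) module_scheme \<Rightarrow> 'a set \<Rightarrow> ('a \<Rightarrow> 'a) \<Rightarrow> 'a set \<Rightarrow> 'a set" where
  "induced_map B I d = (\<lambda>X\<in>carrier (quotient_algebra B I). \<Union>x\<in>X. I +>\<^bsub>B\<^esub> d x)"

end

theory Submission
  imports Defs
begin

text \<open>
  Both conditions are equivalent to \<open>S\<close> being freely generated, as a commutative monoid, by a
  finite set \<open>F\<close>; this is the notion \<open>free_basis\<close>.

  Suppose that \<open>S\<close> is free. Then \<open>k[S]\<close> is a polynomial ring. Given a derivation \<open>d\<close> of \<open>k[S]/I\<close>,
  choose representatives \<open>f\<^sub>b\<close> of the images of the variables. The derivation \<open>\<Sum>\<^sub>b f\<^sub>b \<partial>/\<partial>x\<^sub>b\<close> of \<open>k[S]\<close>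
  agrees with \<open>d\<close> modulo \<open>I\<close> on the variables, hence everywhere, so it preserves \<open>I\<close> and is
  mapped to \<open>d\<close> (\<open>quotient_derivation_lifts\<close>).

  Conversely, suppose that \<open>\<pi>\<close> is always surjective. Since \<open>S\<close> is pointed, the sum of two
  nonzero elements is nonzero, and the elements of a minimal generating set \<open>F\<close> are irreducible.
  Consider the square \<open>I\<close> of the maximal monomial ideal, which is spanned by the monomials whose
  exponent is a sum of two nonzero elements of \<open>S\<close>. In \<open>k[S]/I\<close> all products of monomials of \<open>F\<close>
  are zero, so for each \<open>b \<in> F\<close> the map that fixes \<open>x\<^sup>b\<close> and kills all other monomials is a derivation. Let
  \<open>\<partial>\<close> lift it, and let \<open>p s\<close> be the coefficient of \<open>x\<^sup>s\<close> in \<open>\<partial> x\<^sup>s\<close>. By the Leibniz rule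
  \<open>p\<close> is additive on \<open>S\<close>, and on \<open>F\<close> it is the indicator function of \<open>b\<close>
  (\<open>additive_indicator_if_surjective\<close>). In characteristic zero such functions for all \<open>b \<in> F\<close> read
  off the multiplicity of each generator in an element of \<open>S\<close>, so there are no relations
  between the generators (\<open>free_basis_if_surjective\<close>).

  It remains to see that \<open>F\<close> has \<open>n\<close> elements. As \<open>S\<close> generates \<open>M\<close>, the set \<open>F\<close> is a basis of \<open>M\<close>,
  and a free abelian group with a basis of size \<open>r\<close> has \<open>2\<^sup>r\<close> homomorphisms to \<open>\<int>/2\<close>.
\<close>

section \<open>Semigroup algebras and their quotients\<close>

lemma submonoid_add_iff:
  "submonoid N (add_monoid_on UNIV) \<longleftrightarrow> 0 \<in> N \<and> (\<forall>x\<in>N. \<forall>y\<in>N. x + y \<in> N)"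
  by (auto simp: submonoid_def add_monoid_on_def)

lemma keys_single_times:
  "Poly_Mapping.keys (Poly_Mapping.single 0 c * p) \<subseteq> Poly_Mapping.keys (p :: 'm::comm_monoid_add \<Rightarrow>\<^sub>0 'k::field)"
  by (rule order_trans[OF keys_mult]) auto

lemma poly_mapping_single_induct [consumes 1, case_names zero single add]:
  fixes p :: "'m \<Rightarrow>\<^sub>0 'k::comm_monoid_add"
  assumes "Poly_Mapping.keys p \<subseteq> A"
    and "P 0"
    and "\<And>s c. s \<in> A \<Longrightarrow> P (Poly_Mapping.single s c)"
    and "\<And>x y. \<lbrakk>Poly_Mapping.keys x \<subseteq> A; Poly_Mapping.keys y \<subseteq> A; P x; P y\<rbrakk> \<Longrightarrow> P (x + y)"
  shows "P p"
  using assms(1)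
proof (induction p rule: update_induct)
  case const
  then show ?case using assms(2) by simp
next
  case (update q s c)
  have q: "Poly_Mapping.lookup q s = 0"
    using update.hyps(1) by (simp add: in_keys_iff)
  have eq: "Poly_Mapping.update s c q = Poly_Mapping.single s c + q"
    by (rule poly_mapping_eqI) (auto simp: lookup_update lookup_add lookup_single when_def q)
  have "insert s (Poly_Mapping.keys q) \<subseteq> A"
    using update by (simp add: keys_update)
  then show ?case unfolding eq
    using update assms(3)[of s c] by (intro assms(4)) auto
qed

lemma lookup_single_times:
  fixes q :: "'m::ab_group_add \<Rightarrow>\<^sub>0 'k::field"
  shows "Poly_Mapping.lookup (Poly_Mapping.single t c * q) (t + s) = c * Poly_Mapping.lookup q s"
proof -
  have "Poly_Mapping.keys q \<subseteq> UNIV" by simp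
  then show ?thesis
  proof (induction rule: poly_mapping_single_induct)
    case (single u d)
    then show ?case by (simp add: mult_single lookup_single when_def)
  next
    case (add x y)
    then show ?case by (simp add: distrib_left lookup_add)
  qed simp
qed

lemma lookup_single_times_0:
  fixes q :: "'m::ab_group_add \<Rightarrow>\<^sub>0 'k::field"
  shows "Poly_Mapping.lookup (Poly_Mapping.single 0 c * q) s = c * Poly_Mapping.lookup q s"
  using lookup_single_times[of 0 c q s] by simp

lemma linear_extension_add:
  fixes x y :: "'m::comm_monoid_add \<Rightarrow>\<^sub>0 'k::field"
  shows "(\<Sum>s\<in>Poly_Mapping.keys (x + y). Poly_Mapping.single 0 (Poly_Mapping.lookup (x + y) s) * D s)
    = (\<Sum>s\<in>Poly_Mapping.keys x. Poly_Mapping.single 0 (Poly_Mapping.lookup x s) * D s)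
    + (\<Sum>s\<in>Poly_Mapping.keys y. Poly_Mapping.single 0 (Poly_Mapping.lookup y s) * D s)"
  by (rule setsum_keys_plus_distrib[where f = "\<lambda>s a. Poly_Mapping.single 0 a * D s"])
    (simp_all add: single_add distrib_right)

lemma semigroup_algebra_simps [simp]:
  "carrier (semigroup_algebra S) = {p. Poly_Mapping.keys p \<subseteq> S}"
  "x \<otimes>\<^bsub>semigroup_algebra S\<^esub> y = x * y"
  "\<one>\<^bsub>semigroup_algebra S\<^esub> = 1"
  "\<zero>\<^bsub>semigroup_algebra S\<^esub> = 0"
  "x \<oplus>\<^bsub>semigroup_algebra S\<^esub> y = x + y"
  "c \<odot>\<^bsub>semigroup_algebra S\<^esub> x = Poly_Mapping.single 0 c * x"
  by (simp_all add: semigroup_algebra_def)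

locale additive_submonoid =
  fixes S :: "'m::comm_monoid_add set"
  assumes zero_mem: "0 \<in> S"
    and add_mem: "\<lbrakk>x \<in> S; y \<in> S\<rbrakk> \<Longrightarrow> x + y \<in> S"
begin

lemma keys_times_subset:
  "\<lbrakk>Poly_Mapping.keys x \<subseteq> S; Poly_Mapping.keys y \<subseteq> S\<rbrakk>
    \<Longrightarrow> Poly_Mapping.keys (x * y :: 'm \<Rightarrow>\<^sub>0 'k::field) \<subseteq> S"
  by (rule order_trans[OF keys_mult]) (auto intro: add_mem)

lemma keys_plus_subset:
  "\<lbrakk>Poly_Mapping.keys x \<subseteq> T; Poly_Mapping.keys y \<subseteq> T\<rbrakk>
    \<Longrightarrow> Poly_Mapping.keys (x + y :: 'm \<Rightarrow>\<^sub>0 'k::field) \<subseteq> T"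
  by (rule order_trans[OF keys_add]) auto

lemma cring_semigroup_algebra:
  "cring (semigroup_algebra S :: ('k::field, 'm \<Rightarrow>\<^sub>0 'k) module)"
proof (rule cringI)
  show "abelian_group (semigroup_algebra S :: ('k, 'm \<Rightarrow>\<^sub>0 'k) module)"
  proof (rule abelian_groupI)
    fix x :: "'m \<Rightarrow>\<^sub>0 'k"
    assume "x \<in> carrier (semigroup_algebra S :: ('k, 'm \<Rightarrow>\<^sub>0 'k) module)"
    then show "\<exists>y\<in>carrier (semigroup_algebra S :: ('k, 'm \<Rightarrow>\<^sub>0 'k) module).
        y \<oplus>\<^bsub>(semigroup_algebra S :: ('k, 'm \<Rightarrow>\<^sub>0 'k) module)\<^esub> x
          = \<zero>\<^bsub>(semigroup_algebra S :: ('k, 'm \<Rightarrow>\<^sub>0 'k) module)\<^esub>"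
      by (intro bexI[of _ "- x"]) (auto simp: in_keys_iff)
  qed (auto simp: keys_plus_subset add_ac intro: keys_plus_subset[THEN subsetD])
  show "comm_monoid (semigroup_algebra S :: ('k, 'm \<Rightarrow>\<^sub>0 'k) module)"
    by (rule comm_monoidI)
      (auto simp: mult_ac zero_mem intro: keys_times_subset[THEN subsetD])
qed (auto simp: distrib_right)

end

locale semigroup_algebra_ideal = additive_submonoid S
  for S :: "'m::comm_monoid_add set" +
  fixes I :: "('m \<Rightarrow>\<^sub>0 'k::field) set"
  assumes ideal_I: "ideal I (semigroup_algebra S :: ('k, 'm \<Rightarrow>\<^sub>0 'k) module)"
begin

abbreviation B :: "('k, 'm \<Rightarrow>\<^sub>0 'k) module" where "B \<equiv> semigroup_algebra S"
abbreviation Q :: "('k, ('m \<Rightarrow>\<^sub>0 'k) set) module" where "Q \<equiv> quotient_algebra B I"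
abbreviation coset :: "('m \<Rightarrow>\<^sub>0 'k) \<Rightarrow> ('m \<Rightarrow>\<^sub>0 'k) set" where "coset x \<equiv> I +>\<^bsub>B\<^esub> x"

lemma ideal_is_abelian_subgroup: "abelian_subgroup I B"
proof -
  interpret I: ideal I B by (rule ideal_I)
  show ?thesis by (rule I.abelian_subgroup_axioms)
qed

lemma I_subset: "x \<in> I \<Longrightarrow> Poly_Mapping.keys x \<subseteq> S"
  using additive_subgroup.a_Hcarr[OF ideal.axioms(1)[OF ideal_I]] by simp

lemma I_plus: "\<lbrakk>x \<in> I; y \<in> I\<rbrakk> \<Longrightarrow> x + y \<in> I"
  using additive_subgroup.a_closed[OF ideal.axioms(1)[OF ideal_I], of x y] by simp

lemma I_zero: "0 \<in> I"
  using additive_subgroup.zero_closed[OF ideal.axioms(1)[OF ideal_I]] by simp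

lemma I_times: "\<lbrakk>x \<in> I; Poly_Mapping.keys y \<subseteq> S\<rbrakk> \<Longrightarrow> y * x \<in> I"
  using ideal.I_l_closed[OF ideal_I, of x y] by simp

lemma scalar_in_B: "Poly_Mapping.keys (Poly_Mapping.single 0 c :: 'm \<Rightarrow>\<^sub>0 'k) \<subseteq> S"
  using zero_mem by simp

lemma I_uminus: "x \<in> I \<Longrightarrow> - x \<in> I"
  using I_times[OF _ scalar_in_B[of "- 1"]] 
  by (metis mult_minus1 single_one single_uminus)

lemma coset_eq_iff:
  assumes "Poly_Mapping.keys x \<subseteq> S" "Poly_Mapping.keys y \<subseteq> S"
  shows "coset x = coset y \<longleftrightarrow> x - y \<in> I"
proof -
  interpret I: ideal I B by (rule ideal_I)
  have my: "Poly_Mapping.keys (- y) \<subseteq> S"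
    using assms by (simp add: keys_minus)
  have "\<ominus>\<^bsub>B\<^esub> y = - y"
    by (rule I.minus_equality) (use my assms in auto)
  then have "x \<ominus>\<^bsub>B\<^esub> y = x - y"
    by (simp add: a_minus_def)
  then show ?thesis
    using I.quotient_eq_iff_same_a_r_cos[OF ideal_I, of x y] assms by simp
qed

lemma mem_coset_iff:
  assumes "Poly_Mapping.keys x \<subseteq> S"
  shows "y \<in> coset x \<longleftrightarrow> y - x \<in> I"
proof -
  have "y \<in> coset x \<longleftrightarrow> (\<exists>i\<in>I. y = i + x)"
    by (auto simp: a_r_coset_def r_coset_def)
  also have "\<dots> \<longleftrightarrow> y - x \<in> I"
    by (auto intro!: bexI[of _ "y - x"])
  finally show ?thesis .
qed

lemma mem_coset_carrier:
  assumes "Poly_Mapping.keys x \<subseteq> S" "y \<in> coset x"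
  shows "Poly_Mapping.keys y \<subseteq> S"
proof -
  have "y - x \<in> I" using assms by (simp add: mem_coset_iff)
  then have "Poly_Mapping.keys ((y - x) + x) \<subseteq> S"
    by (intro keys_plus_subset I_subset assms(1))
  then show ?thesis by simp
qed

lemma coset_self: "Poly_Mapping.keys x \<subseteq> S \<Longrightarrow> x \<in> coset x"
  by (simp add: mem_coset_iff I_zero)

lemma carrier_Q: "carrier Q = coset ` {p. Poly_Mapping.keys p \<subseteq> S}"
  by (auto simp: quotient_algebra_def ring.defs FactRing_def A_RCOSETS_def RCOSETS_def a_r_coset_def)

lemma coset_in_Q: "Poly_Mapping.keys x \<subseteq> S \<Longrightarrow> coset x \<in> carrier Q"
  unfolding carrier_Q by (rule imageI) simp

lemma Q_cases:
  assumes "X \<in> carrier Q"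
  obtains x where "X = coset x" "Poly_Mapping.keys x \<subseteq> S"
  using assms unfolding carrier_Q by (elim imageE CollectE)

lemma plus_Q:
  "\<lbrakk>Poly_Mapping.keys x \<subseteq> S; Poly_Mapping.keys y \<subseteq> S\<rbrakk>
    \<Longrightarrow> coset x \<oplus>\<^bsub>Q\<^esub> coset y = coset (x + y)"
  using abelian_subgroup.a_rcos_sum[OF ideal_is_abelian_subgroup, of x y] by (simp add: quotient_algebra_def ring.defs FactRing_def)

lemma times_Q:
  "\<lbrakk>Poly_Mapping.keys x \<subseteq> S; Poly_Mapping.keys y \<subseteq> S\<rbrakk>
    \<Longrightarrow> coset x \<otimes>\<^bsub>Q\<^esub> coset y = coset (x * y)"
  using ideal.rcoset_mult_add[OF ideal_I, of x y] by (simp add: quotient_algebra_def ring.defs FactRing_def)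

text \<open>
  A map that preserves \<open>I\<close> up to subtraction takes all representatives of a class into one class,
  which makes the unions in the definitions of the quotient operations single cosets.
\<close>

lemma Union_coset:
  assumes f: "\<And>y. Poly_Mapping.keys y \<subseteq> S \<Longrightarrow> Poly_Mapping.keys (f y) \<subseteq> S"
    and congr: "\<And>y z. \<lbrakk>Poly_Mapping.keys y \<subseteq> S; Poly_Mapping.keys z \<subseteq> S; y - z \<in> I\<rbrakk> \<Longrightarrow> f y - f z \<in> I"
    and x: "Poly_Mapping.keys x \<subseteq> S"
  shows "(\<Union>y\<in>coset x. coset (f y)) = coset (f x)"
proof -
  have "coset (f y) = coset (f x)" if "y \<in> coset x" for y
  proof -
    have y: "Poly_Mapping.keys y \<subseteq> S"
      by (rule mem_coset_carrier[OF x that])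
    have "y - x \<in> I"
      using that mem_coset_iff[OF x] by blast
    then have "f y - f x \<in> I"
      by (rule congr[OF y x])
    then show ?thesis
      using coset_eq_iff[OF f[OF y] f[OF x]] by blast
  qed
  then show ?thesis
    by (intro UN_constant_eq[OF coset_self[OF x]]) blast
qed

lemma smult_Q:
  assumes "Poly_Mapping.keys x \<subseteq> S"
  shows "c \<odot>\<^bsub>Q\<^esub> coset x = coset (Poly_Mapping.single 0 c * x)"
proof -
  have "c \<odot>\<^bsub>Q\<^esub> coset x = (\<Union>y\<in>coset x. coset (Poly_Mapping.single 0 c * y))"
    by (simp add: quotient_algebra_def ring.extend_def module.fields_def)
  also have "\<dots> = coset (Poly_Mapping.single 0 c * x)"
  proof (rule Union_coset[OF _ _ assms])
    fix y z :: "'m \<Rightarrow>\<^sub>0 'k" assume "y - z \<in> I"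
    then show "Poly_Mapping.single 0 c * y - Poly_Mapping.single 0 c * z \<in> I"
      using I_times[OF _ scalar_in_B] by (simp add: right_diff_distrib[symmetric])
  qed (rule order_trans[OF keys_single_times])
  finally show ?thesis .
qed

lemma induced_map_coset:
  assumes "\<And>x. Poly_Mapping.keys x \<subseteq> S \<Longrightarrow> Poly_Mapping.keys (\<delta> x) \<subseteq> S"
    and "\<And>x y. \<lbrakk>Poly_Mapping.keys x \<subseteq> S; Poly_Mapping.keys y \<subseteq> S\<rbrakk> \<Longrightarrow> \<delta> (x + y) = \<delta> x + \<delta> y"
    and "\<And>x. x \<in> I \<Longrightarrow> \<delta> x \<in> I"
    and "Poly_Mapping.keys x \<subseteq> S"
  shows "induced_map B I \<delta> (coset x) = coset (\<delta> x)"
proof -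
  have "induced_map B I \<delta> (coset x) = (\<Union>y\<in>coset x. coset (\<delta> y))"
    unfolding induced_map_def by (rule restrict_apply'[OF coset_in_Q[OF assms(4)]])
  also have "\<dots> = coset (\<delta> x)"
  proof (rule Union_coset[OF assms(1) _ assms(4)])
    fix y z :: "'m \<Rightarrow>\<^sub>0 'k"
    assume "Poly_Mapping.keys y \<subseteq> S" "Poly_Mapping.keys z \<subseteq> S" and yz: "y - z \<in> I"
    then have "\<delta> ((y - z) + z) = \<delta> (y - z) + \<delta> z"
      using I_subset by (intro assms(2)) auto
    then show "\<delta> y - \<delta> z \<in> I"
      using assms(3)[OF yz] by simp
  qed
  finally show ?thesis .
qed

text \<open>
  The Leibniz rule is required only modulo \<open>I\<close>. This admits linear maps that are not derivations
  of \<open>k[S]\<close>, and the derivations of the quotient that they induce are the candidates for failing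
  to lift.
\<close>

lemma induced_map_in_Der:
  assumes closed: "\<And>x. Poly_Mapping.keys x \<subseteq> S \<Longrightarrow> Poly_Mapping.keys (\<delta> x) \<subseteq> S"
    and add: "\<And>x y. \<lbrakk>Poly_Mapping.keys x \<subseteq> S; Poly_Mapping.keys y \<subseteq> S\<rbrakk> \<Longrightarrow> \<delta> (x + y) = \<delta> x + \<delta> y"
    and scale: "\<And>c x. Poly_Mapping.keys x \<subseteq> S
      \<Longrightarrow> \<delta> (Poly_Mapping.single 0 c * x) = Poly_Mapping.single 0 c * \<delta> x"
    and I: "\<And>x. x \<in> I \<Longrightarrow> \<delta> x \<in> I"
    and leibniz: "\<And>x y. \<lbrakk>Poly_Mapping.keys x \<subseteq> S; Poly_Mapping.keys y \<subseteq> S\<rbrakk>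
      \<Longrightarrow> \<delta> (x * y) - (x * \<delta> y + \<delta> x * y) \<in> I"
  shows "induced_map B I \<delta> \<in> Der Q"
proof -
  note ind = induced_map_coset[of \<delta>, OF closed add I]
  have scaled: "Poly_Mapping.keys (Poly_Mapping.single 0 c * x) \<subseteq> S"
    if "Poly_Mapping.keys x \<subseteq> S" for c and x :: "'m \<Rightarrow>\<^sub>0 'k"
    using order_trans[OF keys_single_times that] .
  have "induced_map B I \<delta> \<in> carrier Q \<rightarrow>\<^sub>E carrier Q"
  proof (rule PiE_I)
    fix X assume "X \<in> carrier Q"
    then show "induced_map B I \<delta> X \<in> carrier Q"
    proof (rule Q_cases)
      fix x assume "X = coset x" "Poly_Mapping.keys x \<subseteq> S"
      then show ?thesis by (simp only: ind coset_in_Q closed)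
    qed
  next
    fix X assume "X \<notin> carrier Q"
    then show "induced_map B I \<delta> X = undefined"
      by (simp only: induced_map_def restrict_def if_False)
  qed
  moreover have "induced_map B I \<delta> (X \<oplus>\<^bsub>Q\<^esub> Y)
      = induced_map B I \<delta> X \<oplus>\<^bsub>Q\<^esub> induced_map B I \<delta> Y"
    if "X \<in> carrier Q" "Y \<in> carrier Q" for X Y
    using that by (elim Q_cases) (simp only: plus_Q ind keys_plus_subset closed add)
  moreover have "induced_map B I \<delta> (c \<odot>\<^bsub>Q\<^esub> X) = c \<odot>\<^bsub>Q\<^esub> induced_map B I \<delta> X"
    if "X \<in> carrier Q" for c X
    using that by (elim Q_cases) (simp only: smult_Q ind scaled closed scale)
  moreover have "induced_map B I \<delta> (X \<otimes>\<^bsub>Q\<^esub> Y)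
      = (X \<otimes>\<^bsub>Q\<^esub> induced_map B I \<delta> Y) \<oplus>\<^bsub>Q\<^esub> (induced_map B I \<delta> X \<otimes>\<^bsub>Q\<^esub> Y)"
    if "X \<in> carrier Q" "Y \<in> carrier Q" for X Y
    using that by (elim Q_cases)
      (simp only: times_Q plus_Q ind keys_times_subset keys_plus_subset closed coset_eq_iff leibniz)
  ultimately show ?thesis
    unfolding Der_def by (intro CollectI conjI ballI allI)
qed

lemma DerB_D:
  assumes "\<delta> \<in> Der B"
  shows "Poly_Mapping.keys x \<subseteq> S \<Longrightarrow> Poly_Mapping.keys (\<delta> x) \<subseteq> S"
    and "\<lbrakk>Poly_Mapping.keys x \<subseteq> S; Poly_Mapping.keys y \<subseteq> S\<rbrakk> \<Longrightarrow> \<delta> (x + y) = \<delta> x + \<delta> y"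
    and "Poly_Mapping.keys x \<subseteq> S \<Longrightarrow> \<delta> (Poly_Mapping.single 0 c * x) = Poly_Mapping.single 0 c * \<delta> x"
    and "\<lbrakk>Poly_Mapping.keys x \<subseteq> S; Poly_Mapping.keys y \<subseteq> S\<rbrakk> \<Longrightarrow> \<delta> (x * y) = x * \<delta> y + \<delta> x * y"
proof -
  have "\<delta> \<in> {p. Poly_Mapping.keys p \<subseteq> S} \<rightarrow>\<^sub>E {p. Poly_Mapping.keys p \<subseteq> S}"
    using assms by (simp add: Der_def)
  then show "Poly_Mapping.keys x \<subseteq> S \<Longrightarrow> Poly_Mapping.keys (\<delta> x) \<subseteq> S"
    by (drule_tac PiE_mem[where x = x]) simp_all
qed (use assms in \<open>simp_all add: Der_def\<close>)

lemma induced_map_Der_ideal: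
  assumes "\<delta> \<in> Der_ideal B I"
  shows "induced_map B I \<delta> \<in> Der Q"
    and "Poly_Mapping.keys x \<subseteq> S \<Longrightarrow> induced_map B I \<delta> (coset x) = coset (\<delta> x)"
proof -
  have \<delta>: "\<delta> \<in> Der B" and I: "\<And>x. x \<in> I \<Longrightarrow> \<delta> x \<in> I"
    using assms by (auto simp: Der_ideal_def)
  note d = DerB_D[OF \<delta>]
  show "induced_map B I \<delta> \<in> Der Q"
    by (rule induced_map_in_Der) (use d I I_zero in auto)
  show "induced_map B I \<delta> (coset x) = coset (\<delta> x)" if "Poly_Mapping.keys x \<subseteq> S"
    by (rule induced_map_coset) (use d I that in auto)
qed

text \<open>
  The class of an element of \<open>I\<close> is zero, and \<open>d\<close> maps zero to zero. This is why a derivation of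
  \<open>k[S]\<close> that represents \<open>d\<close> on classes preserves \<open>I\<close>.
\<close>

lemma lift_of_quotient_derivation:
  assumes \<delta>: "\<delta> \<in> Der B" and d: "d \<in> Der Q"
    and lift: "\<And>x. Poly_Mapping.keys x \<subseteq> S \<Longrightarrow> d (coset x) = coset (\<delta> x)"
  shows "\<delta> \<in> Der_ideal B I" and "induced_map B I \<delta> = d"
proof -
  note dB = DerB_D[OF \<delta>]
  have "d (coset 0) = coset 0"
    using lift[of 0] dB(2)[of 0 0] by simp
  have "\<delta> x \<in> I" if x: "x \<in> I" for x
  proof -
    have "coset x = coset 0"
      using coset_eq_iff[OF I_subset[OF x], of 0] x by simp
    then have "coset (\<delta> x) = coset 0"
      using lift[OF I_subset[OF x]] \<open>d (coset 0) = coset 0\<close> by argo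
    then show ?thesis
      using coset_eq_iff[OF dB(1)[OF I_subset[OF x]], of 0] by simp
  qed
  then show di: "\<delta> \<in> Der_ideal B I"
    using \<delta> by (auto simp: Der_ideal_def)
  have "induced_map B I \<delta> X = d X" for X
  proof (cases "X \<in> carrier Q")
    case True
    then show ?thesis
      by (elim Q_cases) (simp only: induced_map_Der_ideal(2)[OF di] lift)
  next
    case False
    moreover have "d X = undefined"
      using d False unfolding Der_def by (blast dest: PiE_arb)
    ultimately show ?thesis by (simp only: induced_map_def restrict_def if_False)
  qed
  then show "induced_map B I \<delta> = d" ..
qed

end

section \<open>Generators of a positive semigroup\<close>

definition generates :: "'m::comm_monoid_add set \<Rightarrow> 'm set \<Rightarrow> bool" where
  "generates S F \<longleftrightarrow> F \<subseteq> S \<and> (\<forall>N. 0 \<in> N \<and> (\<forall>x\<in>N. \<forall>y\<in>N. x + y \<in> N) \<and> F \<subseteq> N \<longrightarrow> S \<subseteq> N)"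

lemma generatesD:
  assumes "generates S F" and "0 \<in> N" and "\<And>x y. \<lbrakk>x \<in> N; y \<in> N\<rbrakk> \<Longrightarrow> x + y \<in> N" and "F \<subseteq> N"
  shows "S \<subseteq> N"
  using assms unfolding generates_def by simp

lemma (in additive_submonoid) generates_induct [consumes 2, case_names zero gen add]:
  assumes "generates S F" "s \<in> S"
    and "P 0" and "\<And>g. g \<in> F \<Longrightarrow> P g"
    and "\<And>x y. \<lbrakk>x \<in> S; y \<in> S; P x; P y\<rbrakk> \<Longrightarrow> P (x + y)"
  shows "P s"
proof -
  let ?N = "{s \<in> S. P s}"
  have "S \<subseteq> ?N"
  proof (rule generatesD[OF assms(1)])
    show "F \<subseteq> ?N" using assms(1,4) by (auto simp: generates_def)
  qed (use assms(3,5) zero_mem add_mem in auto)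
  then show ?thesis using assms(2) by auto
qed

locale positive_semigroup = additive_submonoid S for S :: "'m::ab_group_add set" +
  assumes positive: "\<lbrakk>x \<in> S; y \<in> S; x + y = 0\<rbrakk> \<Longrightarrow> x = 0"
begin

lemma minimal_generators:
  assumes "finite F0" "generates S F0"
  obtains F where "finite F" "generates S F" "\<And>b. b \<in> F \<Longrightarrow> \<not> generates S (F - {b})"
proof -
  let ?P = "\<lambda>F. finite F \<and> generates S F"
  have "\<exists>F. ?P F \<and> (\<forall>G. ?P G \<longrightarrow> card F \<le> card G)"
    by (rule ex_has_least_nat[of ?P F0 card]) (use assms in simp)
  then obtain F where *: "?P F \<and> (\<forall>G. ?P G \<longrightarrow> card F \<le> card G)" ..
  note F = conjunct1[OF *] and min = conjunct2[OF *]
  have "\<not> generates S (F - {b})" if "b \<in> F" for b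
  proof
    assume "generates S (F - {b})"
    then have "card F \<le> card (F - {b})"
      using F by (intro min[rule_format]) simp
    moreover have "card (F - {b}) < card F"
      by (rule card_Diff1_less[OF conjunct1[OF F] that])
    ultimately show False by linarith
  qed
  then show thesis by (rule that[OF conjunct1[OF F] conjunct2[OF F]])
qed

text \<open>
  A minimal generator \<open>b\<close> is irreducible: every element of \<open>S\<close> is either generated by the other
  generators or of the form \<open>b + t\<close>. If both summands of \<open>b = u + v\<close> are of the first kind, then
  \<open>b\<close> is redundant; if one of them is of the second kind, then the other one vanishes by positivity.
\<close>

lemma minimal_generator_irreducible:
  assumes F: "generates S F" and b: "b \<in> F" "\<not> generates S (F - {b})"
    and uv: "u \<in> S" "v \<in> S" "b = u + v"
  shows "u = 0 \<or> v = 0"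
proof -
  have FS: "F \<subseteq> S" using F by (simp add: generates_def)
  have "F - {b} \<subseteq> S" using FS by blast
  then have "\<exists>N. 0 \<in> N \<and> (\<forall>x\<in>N. \<forall>y\<in>N. x + y \<in> N) \<and> F - {b} \<subseteq> N \<and> \<not> S \<subseteq> N"
    using b(2) by (simp only: generates_def simp_thms not_all not_imp conj_assoc)
  then obtain N where N: "0 \<in> N" "\<And>x y. \<lbrakk>x \<in> N; y \<in> N\<rbrakk> \<Longrightarrow> x + y \<in> N" "F - {b} \<subseteq> N" "\<not> S \<subseteq> N"
    by (elim exE conjE) (rule that; simp)
  have bN: "b \<notin> N"
  proof
    assume "b \<in> N"
    then have "F \<subseteq> N" using N(3) by blast
    then show False using generatesD[OF F N(1,2)] N(4) by blast
  qed
  have split: "s \<in> N \<or> (\<exists>t\<in>S. s = b + t)" if "s \<in> S" for s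
    using F that
  proof (induction rule: generates_induct)
    case zero
    then show ?case using N(1) by simp
  next
    case (gen g)
    show ?case
    proof (cases "g = b")
      case True
      then show ?thesis by (intro disjI2 bexI[of _ 0]) (auto simp: zero_mem)
    next
      case False
      then show ?thesis using gen N(3) by blast
    qed
  next
    case (add x y)
    consider "x \<in> N" "y \<in> N" | t where "t \<in> S" "x = b + t" | t where "t \<in> S" "y = b + t"
      using add by blast
    then show ?case
    proof cases
      case 1
      then show ?thesis using N(2) by blast
    next
      case 2
      then show ?thesis using add_mem[of t y] add(2)
        by (intro disjI2 bexI[of _ "t + y"]) (simp_all add: add.assoc)
    next
      case 3
      then show ?thesis using add_mem[of t x] add(1)
        by (intro disjI2 bexI[of _ "t + x"]) (simp_all add: ac_simps)
    qed
  qed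
  consider "u \<in> N" "v \<in> N" | t where "t \<in> S" "u = b + t" | t where "t \<in> S" "v = b + t"
    using split[OF uv(1)] split[OF uv(2)] by metis
  then show ?thesis
  proof cases
    case 1
    then show ?thesis using N(2)[of u v] bN uv(3) by simp
  next
    case 2
    then have "v + t = 0" using uv(3) by (simp add: algebra_simps)
    then show ?thesis using positive[OF uv(2) 2(1)] by simp
  next
    case 3
    then have "u + t = 0" using uv(3) by (simp add: algebra_simps)
    then show ?thesis using positive[OF uv(1) 3(1)] by simp
  qed
qed

lemma minimal_generator_nonzero:
  assumes "generates S F" "\<not> generates S (F - {b})"
  shows "b \<noteq> 0"
proof
  assume b: "b = 0"
  have "generates S (F - {b})"
    unfolding generates_def
  proof (intro conjI allI impI)
    show "F - {b} \<subseteq> S" using assms(1) by (auto simp: generates_def)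
    fix N assume N: "0 \<in> N \<and> (\<forall>x\<in>N. \<forall>y\<in>N. x + y \<in> N) \<and> F - {b} \<subseteq> N"
    show "S \<subseteq> N"
    proof (rule generatesD[OF assms(1)])
      show "F \<subseteq> N" using N b by blast
    qed (use N in simp_all)
  qed
  then show False using assms(2) by contradiction
qed

end

locale irreducible_generators = positive_semigroup S for S :: "'m::ab_group_add set" +
  fixes F :: "'m set"
  assumes finite_F: "finite F"
    and gen_F: "generates S F"
    and irreducible: "\<lbrakk>b \<in> F; u \<in> S; v \<in> S; b = u + v\<rbrakk> \<Longrightarrow> u = 0 \<or> v = 0"
    and nonzero_F: "0 \<notin> F"
begin

lemma F_subset: "b \<in> F \<Longrightarrow> b \<in> S"
  using gen_F by (auto simp: generates_def)

section \<open>The square of the maximal monomial ideal\<close>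

definition reducible :: "'m set" where
  "reducible = {u + v | u v. u \<in> S - {0} \<and> v \<in> S - {0}}"

lemma reducible_subset: "reducible \<subseteq> S"
  by (auto simp: reducible_def intro: add_mem)

lemma reducible_plus:
  assumes "s \<in> reducible" "t \<in> S" shows "t + s \<in> reducible"
proof -
  obtain u v where uv: "s = u + v" "u \<in> S - {0}" "v \<in> S - {0}"
    using assms(1) by (auto simp: reducible_def)
  then have "t + v \<in> S - {0}"
    using positive[of v t] add_mem assms(2) by (auto simp: add.commute)
  then show ?thesis
    using uv unfolding reducible_def
    by (intro CollectI exI[of _ u] exI[of _ "t + v"]) (simp add: ac_simps)
qed

lemma F_not_reducible: "b \<in> F \<Longrightarrow> b \<notin> reducible"
  using irreducible by (auto simp: reducible_def)

definition square_ideal :: "('m \<Rightarrow>\<^sub>0 'k::field) set" where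
  "square_ideal = {p. Poly_Mapping.keys p \<subseteq> reducible}"

lemma ideal_square_ideal:
  "ideal square_ideal (semigroup_algebra S :: ('k::field, 'm \<Rightarrow>\<^sub>0 'k) module)"
proof -
  interpret R: cring "semigroup_algebra S :: ('k, 'm \<Rightarrow>\<^sub>0 'k) module"
    by (rule cring_semigroup_algebra)
  have mult: "x * a \<in> square_ideal"
    if "a \<in> square_ideal" "Poly_Mapping.keys x \<subseteq> S" for a x :: "'m \<Rightarrow>\<^sub>0 'k"
  proof -
    have "Poly_Mapping.keys (x * a) \<subseteq> reducible"
      by (rule order_trans[OF keys_mult]) (use that reducible_plus in \<open>auto simp: square_ideal_def\<close>)
    then show ?thesis by (simp add: square_ideal_def)
  qed
  have min: "\<ominus>\<^bsub>semigroup_algebra S\<^esub> a = - a" if "a \<in> square_ideal" for a :: "'m \<Rightarrow>\<^sub>0 'k"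
    by (rule R.minus_equality) (use that reducible_subset in \<open>auto simp: square_ideal_def\<close>)
  show ?thesis
  proof (rule idealI)
    show "subgroup square_ideal (add_monoid (semigroup_algebra S :: ('k, 'm \<Rightarrow>\<^sub>0 'k) module))"
    proof (rule R.add.subgroupI)
      show "square_ideal \<subseteq> carrier (semigroup_algebra S :: ('k, 'm \<Rightarrow>\<^sub>0 'k) module)"
        using reducible_subset by (auto simp: square_ideal_def)
      have "(0 :: 'm \<Rightarrow>\<^sub>0 'k) \<in> square_ideal" by (simp add: square_ideal_def)
      then show "square_ideal \<noteq> ({} :: ('m \<Rightarrow>\<^sub>0 'k) set)" by blast
      fix a :: "'m \<Rightarrow>\<^sub>0 'k" assume a: "a \<in> square_ideal"
      show "\<ominus>\<^bsub>(semigroup_algebra S :: ('k, 'm \<Rightarrow>\<^sub>0 'k) module)\<^esub> a \<in> square_ideal"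
        unfolding min[OF a] using a by (simp add: square_ideal_def)
      fix b :: "'m \<Rightarrow>\<^sub>0 'k" assume b: "b \<in> square_ideal"
      show "a \<oplus>\<^bsub>(semigroup_algebra S :: ('k, 'm \<Rightarrow>\<^sub>0 'k) module)\<^esub> b \<in> square_ideal"
        using a b by (simp add: square_ideal_def keys_plus_subset)
    qed
  qed (use R.ring_axioms mult in \<open>simp_all add: mult.commute\<close>)
qed

lemma nonzero_cases:
  assumes "s \<in> S" "s \<noteq> 0"
  obtains f t where "f \<in> F" "t \<in> S" "s = f + t"
proof -
  have "s = 0 \<or> (\<exists>f\<in>F. \<exists>t\<in>S. s = f + t)"
    using gen_F assms(1)
  proof (induction rule: generates_induct)
    case (gen g)
    then show ?case by (intro disjI2 bexI[of _ g] bexI[of _ 0]) (auto simp: zero_mem)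
  next
    case (add x y)
    from add(3) show ?case
    proof (elim disjE bexE)
      fix f t assume "f \<in> F" "t \<in> S" "x = f + t"
      then show ?thesis using add_mem[of t y] add(2) by (auto simp: add.assoc)
    qed (use add(4) in simp)
  qed simp
  then show thesis using assms(2) that by blast
qed

text \<open>
  Every nonzero element of \<open>S\<close> has a summand in \<open>F\<close>, so the monomials of \<open>square_ideal\<close> are the
  multiples of the finitely many \<open>x\<^sup>f\<^sup>+\<^sup>g\<close> with \<open>f, g \<in> F\<close>.
\<close>

lemma monomial_ideal_square_ideal:
  "monomial_ideal S (square_ideal :: ('m \<Rightarrow>\<^sub>0 'k::field) set)"
proof -
  let ?B = "semigroup_algebra S :: ('k, 'm \<Rightarrow>\<^sub>0 'k) module"
  let ?E = "(\<lambda>(f, g). f + g) ` (F \<times> F)"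
  let ?G = "genideal ?B (monomial ` ?E)"
  interpret R: cring ?B by (rule cring_semigroup_algebra)
  have ES: "?E \<subseteq> S"
    using F_subset add_mem by auto
  have carr: "monomial ` ?E \<subseteq> carrier ?B"
    using ES by (auto simp: monomial_def)
  have "?E \<subseteq> reducible"
    using F_subset nonzero_F by (force simp: reducible_def)
  then have "monomial ` ?E \<subseteq> (square_ideal :: ('m \<Rightarrow>\<^sub>0 'k) set)"
    by (auto simp: square_ideal_def monomial_def)
  then have "?G \<subseteq> square_ideal"
    by (rule R.genideal_minimal[OF ideal_square_ideal])
  moreover have "x \<in> ?G" if "x \<in> square_ideal" for x
  proof -
    interpret G: semigroup_algebra_ideal S ?G
      by (intro semigroup_algebra_ideal.intro semigroup_algebra_ideal_axioms.intro
          additive_submonoid_axioms R.genideal_ideal[OF carr])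
    have "Poly_Mapping.keys x \<subseteq> reducible"
      using that by (simp add: square_ideal_def)
    then show ?thesis
    proof (induction rule: poly_mapping_single_induct)
      case (single s c)
      then obtain u v where uv: "s = u + v" "u \<in> S" "u \<noteq> 0" "v \<in> S" "v \<noteq> 0"
        by (auto simp: reducible_def)
      obtain f t where f: "f \<in> F" "t \<in> S" "u = f + t" using nonzero_cases[OF uv(2,3)] .
      obtain g r where g: "g \<in> F" "r \<in> S" "v = g + r" using nonzero_cases[OF uv(4,5)] .
      have "monomial (f + g) \<in> ?G"
        using R.genideal_self[OF carr] f(1) g(1) by blast
      then have "Poly_Mapping.single (t + r) c * monomial (f + g) \<in> ?G"
        by (rule G.I_times) (use f g add_mem in simp)
      moreover have "Poly_Mapping.single (t + r) c * monomial (f + g) = Poly_Mapping.single s c"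
        by (simp add: monomial_def mult_single uv f g ac_simps)
      ultimately show ?case by metis
    qed (auto intro: G.I_zero G.I_plus)
  qed
  ultimately have "square_ideal = ?G" by blast
  then show ?thesis
    unfolding monomial_ideal_def using finite_F ES by (intro exI[of _ ?E]) simp
qed

lemma semigroup_algebra_ideal_square:
  "semigroup_algebra_ideal S (square_ideal :: ('m \<Rightarrow>\<^sub>0 'k::field) set)"
  by (intro semigroup_algebra_ideal.intro semigroup_algebra_ideal_axioms.intro
      additive_submonoid_axioms ideal_square_ideal)

definition line_projection :: "'m \<Rightarrow> ('m \<Rightarrow>\<^sub>0 'k::field) \<Rightarrow> ('m \<Rightarrow>\<^sub>0 'k)" where
  "line_projection b x = Poly_Mapping.single b (Poly_Mapping.lookup x b)"

text \<open>
  The quotient by \<open>square_ideal\<close> is \<open>k\<close> plus the span of the monomials of \<open>F\<close>, and products of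
  the latter are zero. Hence every linear endomorphism of that span, extended by zero on the
  constants, is a derivation of the quotient, among them the diagonal ones considered here.
\<close>

lemma line_projection_Leibniz:
  fixes x y :: "'m \<Rightarrow>\<^sub>0 'k::field"
  assumes b: "b \<in> F" and x: "Poly_Mapping.keys x \<subseteq> S" and y: "Poly_Mapping.keys y \<subseteq> S"
  shows "line_projection b (x * y) - (x * line_projection b y + line_projection b x * y) \<in> square_ideal"
proof -
  interpret J: semigroup_algebra_ideal S "square_ideal :: ('m \<Rightarrow>\<^sub>0 'k) set"
    by (rule semigroup_algebra_ideal_square)
  let ?D = "line_projection b :: ('m \<Rightarrow>\<^sub>0 'k) \<Rightarrow> _"
  have b0: "b \<noteq> 0" and bS: "b \<in> S" using b nonzero_F F_subset by auto
  have add: "?D (p + q) = ?D p + ?D q" for p q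
    by (simp add: line_projection_def lookup_add single_add)
  have scale: "?D (Poly_Mapping.single 0 c * p) = Poly_Mapping.single 0 c * ?D p" for c p
    by (simp add: line_projection_def mult_single lookup_single_times_0)
  have const: "?D (Poly_Mapping.single 0 c) = 0" for c
    using b0 by (simp add: line_projection_def lookup_single)
  \<comment> \<open>Split off the constant terms: products of two elements without constant term vanish modulo
    \<open>square_ideal\<close>.\<close>
  define a where "a = Poly_Mapping.lookup x 0"
  define d where "d = Poly_Mapping.lookup y 0"
  define x' where "x' = x - Poly_Mapping.single 0 a"
  define y' where "y' = y - Poly_Mapping.single 0 d"
  have x': "Poly_Mapping.keys x' \<subseteq> S - {0}"
    using x by (auto simp: x'_def a_def in_keys_iff lookup_minus lookup_single when_def split: if_splits)
  have y': "Poly_Mapping.keys y' \<subseteq> S - {0}"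
    using y by (auto simp: y'_def d_def in_keys_iff lookup_minus lookup_single when_def split: if_splits)
  have prod: "p * q \<in> square_ideal"
    if "Poly_Mapping.keys p \<subseteq> S - {0}" "Poly_Mapping.keys q \<subseteq> S - {0}" for p q :: "'m \<Rightarrow>\<^sub>0 'k"
    unfolding square_ideal_def reducible_def using that keys_mult[of p q] by blast
  have line: "Poly_Mapping.keys (?D p) \<subseteq> S - {0}" for p
    using b0 bS by (simp add: line_projection_def)
  have "Poly_Mapping.lookup (x' * y') b = 0"
    using prod[OF x' y'] F_not_reducible[OF b] by (auto simp: square_ideal_def in_keys_iff)
  then have kill: "?D (x' * y') = 0"
    by (simp add: line_projection_def)
  have x_eq: "x = Poly_Mapping.single 0 a + x'" and y_eq: "y = Poly_Mapping.single 0 d + y'"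
    by (simp_all add: x'_def y'_def)
  have "x * y = Poly_Mapping.single 0 (a * d) + Poly_Mapping.single 0 a * y'
      + Poly_Mapping.single 0 d * x' + x' * y'"
    unfolding x_eq y_eq by (simp add: algebra_simps mult_single)
  then have "?D (x * y) = Poly_Mapping.single 0 a * ?D y' + Poly_Mapping.single 0 d * ?D x'"
    by (simp only: add scale const kill add_0_left add_0_right)
  moreover have "?D x = ?D x'" "?D y = ?D y'"
    unfolding x_eq y_eq by (simp_all only: add const add_0_left add_0_right)
  ultimately have "?D (x * y) - (x * ?D y + ?D x * y) = - (x' * ?D y' + ?D x' * y')"
    unfolding x_eq y_eq by (simp add: algebra_simps)
  moreover have "- (x' * ?D y' + ?D x' * y') \<in> square_ideal"
    by (intro J.I_uminus J.I_plus prod x' y' line)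
  ultimately show ?thesis by simp
qed

text \<open>
  The diagonal part of a lift of the derivation induced by \<open>line_projection b\<close>, that is, the
  function taking \<open>s\<close> to the coefficient of \<open>x\<^sup>s\<close> in the image of \<open>x\<^sup>s\<close>, is additive by the Leibniz rule.
\<close>

lemma additive_indicator_if_surjective:
  fixes b :: 'm
  assumes b: "b \<in> F"
    and surj: "Der (quotient_algebra (semigroup_algebra S :: ('k::field, 'm \<Rightarrow>\<^sub>0 'k) module) square_ideal)
      \<subseteq> induced_map (semigroup_algebra S) square_ideal ` Der_ideal (semigroup_algebra S) square_ideal"
  shows "\<exists>p :: 'm \<Rightarrow> 'k. (\<forall>s\<in>S. \<forall>t\<in>S. p (s + t) = p s + p t) \<and> (\<forall>g\<in>F. p g = of_bool (g = b))"
proof -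
  interpret J: semigroup_algebra_ideal S "square_ideal :: ('m \<Rightarrow>\<^sub>0 'k) set"
    by (rule semigroup_algebra_ideal_square)
  let ?D = "line_projection b :: ('m \<Rightarrow>\<^sub>0 'k) \<Rightarrow> _"
  have D_closed: "Poly_Mapping.keys (?D x) \<subseteq> S" for x
    using F_subset[OF b] by (simp add: line_projection_def)
  have D_add: "?D (x + y) = ?D x + ?D y" for x y
    by (simp add: line_projection_def lookup_add single_add)
  have D_I: "?D x \<in> square_ideal" if "x \<in> square_ideal" for x
  proof -
    have "Poly_Mapping.lookup x b = 0"
      using that F_not_reducible[OF b] by (auto simp: square_ideal_def in_keys_iff)
    then show ?thesis by (simp add: line_projection_def J.I_zero)
  qed
  have "induced_map J.B square_ideal ?D \<in> Der J.Q"
  proof (rule J.induced_map_in_Der[OF D_closed D_add _ D_I line_projection_Leibniz[OF b]])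
    fix c :: 'k and x :: "'m \<Rightarrow>\<^sub>0 'k"
    show "?D (Poly_Mapping.single 0 c * x) = Poly_Mapping.single 0 c * ?D x"
      by (simp add: line_projection_def mult_single lookup_single_times_0)
  qed
  then obtain \<delta> where \<delta>: "\<delta> \<in> Der_ideal J.B square_ideal"
    and eq: "induced_map J.B square_ideal ?D = induced_map J.B square_ideal \<delta>"
    using subsetD[OF surj] by (metis imageE)
  have Der: "\<delta> \<in> Der J.B" using \<delta> by (simp add: Der_ideal_def)
  have diff: "\<delta> x - ?D x \<in> square_ideal" if x: "Poly_Mapping.keys x \<subseteq> S" for x
  proof -
    have "J.coset (\<delta> x) = J.coset (?D x)"
      using J.induced_map_coset[of ?D, OF D_closed D_add D_I x] J.induced_map_Der_ideal(2)[OF \<delta> x]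
        eq by simp
    then show ?thesis
      using J.coset_eq_iff[OF J.DerB_D(1)[OF Der x] D_closed] by simp
  qed
  let ?p = "\<lambda>s. Poly_Mapping.lookup (\<delta> (Poly_Mapping.single s 1)) s"
  show ?thesis
  proof (intro exI[of _ ?p] conjI ballI)
    fix s t assume "s \<in> S" "t \<in> S"
    then have "\<delta> (Poly_Mapping.single s 1 * Poly_Mapping.single t 1)
        = Poly_Mapping.single s 1 * \<delta> (Poly_Mapping.single t 1)
          + Poly_Mapping.single t 1 * \<delta> (Poly_Mapping.single s 1)"
      by (subst J.DerB_D(4)[OF Der]) (simp_all add: mult.commute)
    moreover have "Poly_Mapping.lookup (Poly_Mapping.single t 1 * q) (s + t) = Poly_Mapping.lookup q s"
      for q :: "'m \<Rightarrow>\<^sub>0 'k"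
      using lookup_single_times[of t 1 q s] by (simp add: add.commute[of t s])
    ultimately show "?p (s + t) = ?p s + ?p t"
      by (simp add: mult_single lookup_add lookup_single_times)
  next
    fix g assume g: "g \<in> F"
    let ?x = "Poly_Mapping.single g 1 :: 'm \<Rightarrow>\<^sub>0 'k"
    have "\<delta> ?x - ?D ?x \<in> square_ideal"
      using F_subset[OF g] by (intro diff) simp
    then have "Poly_Mapping.lookup (\<delta> ?x - ?D ?x) g = 0"
      using F_not_reducible[OF g] by (auto simp: square_ideal_def in_keys_iff)
    then show "?p g = of_bool (g = b)"
      by (auto simp: lookup_minus line_projection_def lookup_single when_def split: if_splits)
  qed
qed

end

section \<open>Free generators\<close>

text \<open>
  \<open>S\<close> is freely generated by \<open>F\<close>, with \<open>c b s\<close> the multiplicity of \<open>b\<close> in \<open>s\<close>. Freeness is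
  encoded by the existence of the additive coordinate functions.
\<close>

definition free_basis :: "'m::comm_monoid_add set \<Rightarrow> 'm set \<Rightarrow> ('m \<Rightarrow> 'm \<Rightarrow> nat) \<Rightarrow> bool" where
  "free_basis S F c \<longleftrightarrow> finite F \<and> generates S F
    \<and> (\<forall>b\<in>F. \<forall>s\<in>S. \<forall>t\<in>S. c b (s + t) = c b s + c b t)
    \<and> (\<forall>b\<in>F. \<forall>g\<in>F. c b g = of_bool (g = b))"

text \<open>
  Additivity forces the indicator function of \<open>b\<close> in \<open>F\<close> to extend to a function on \<open>S\<close> with
  values in the image of \<open>\<nat>\<close> in \<open>k\<close>, which is a copy of \<open>\<nat>\<close> because the characteristic is zero.
\<close>

lemma (in irreducible_generators) free_basis_if_surjective:
  assumes surj: "Der (quotient_algebra (semigroup_algebra S :: ('k::field_char_0, 'm \<Rightarrow>\<^sub>0 'k) module) square_ideal)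
      \<subseteq> induced_map (semigroup_algebra S) square_ideal ` Der_ideal (semigroup_algebra S) square_ideal"
  obtains c where "free_basis S F c"
proof -
  have "\<exists>c. (\<forall>s\<in>S. \<forall>t\<in>S. c (s + t) = c s + c t) \<and> (\<forall>g\<in>F. c g = (of_bool (g = b) :: nat))"
    if b: "b \<in> F" for b
  proof -
    obtain p :: "'m \<Rightarrow> 'k" where p: "(\<forall>s\<in>S. \<forall>t\<in>S. p (s + t) = p s + p t) \<and> (\<forall>g\<in>F. p g = of_bool (g = b))"
      using additive_indicator_if_surjective[OF b surj] ..
    have p_add: "p (s + t) = p s + p t" if "s \<in> S" "t \<in> S" for s t
      using p that by simp
    have p_gen: "p g = of_bool (g = b)" if "g \<in> F" for g
      using p that by simp
    have "\<exists>k :: nat. p s = of_nat k" if "s \<in> S" for s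
      using gen_F that
    proof (induction rule: generates_induct)
      case zero
      have "p 0 = 0" using p_add[of 0 0] zero_mem by simp
      then show ?case by (intro exI[of _ 0]) simp
    next
      case (gen g)
      then show ?case by (intro exI[of _ "of_bool (g = b)"]) (simp add: p_gen)
    next
      case (add x y)
      then obtain k l :: nat where "p x = of_nat k" "p y = of_nat l" by (elim exE)
      then show ?case
        using p_add[OF add(1,2)] by (intro exI[of _ "k + l"]) simp
    qed
    then obtain c :: "'m \<Rightarrow> nat" where c: "\<And>s. s \<in> S \<Longrightarrow> p s = of_nat (c s)"
      by metis
    have "c (s + t) = c s + c t" if "s \<in> S" "t \<in> S" for s t
    proof -
      have "of_nat (c (s + t)) = (of_nat (c s + c t) :: 'k)"
        using p_add[OF that] c[OF that(1)] c[OF that(2)] c[OF add_mem[OF that]] by simp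
      then show ?thesis by (simp only: of_nat_eq_iff)
    qed
    moreover have "c g = of_bool (g = b)" if "g \<in> F" for g
    proof -
      have "of_nat (c g) = (of_nat (of_bool (g = b)) :: 'k)"
        using p_gen[OF that] c[OF F_subset[OF that]] by simp
      then show ?thesis by (simp only: of_nat_eq_iff)
    qed
    ultimately show ?thesis by (intro exI[of _ c]) simp
  qed
  then obtain c where "\<forall>b\<in>F. (\<forall>s\<in>S. \<forall>t\<in>S. c b (s + t) = c b s + c b t)
      \<and> (\<forall>g\<in>F. c b g = (of_bool (g = b) :: nat))"
    by metis
  then show thesis
    by (intro that[of c]) (simp add: free_basis_def finite_F gen_F)
qed

section \<open>Lifting derivations along free generators\<close>

lemma (in semigroup_algebra_ideal) DerQ_D:
  assumes "d \<in> Der Q"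
  shows "Poly_Mapping.keys x \<subseteq> S \<Longrightarrow> \<exists>p. Poly_Mapping.keys p \<subseteq> S \<and> d (coset x) = coset p"
    and "\<lbrakk>Poly_Mapping.keys x \<subseteq> S; Poly_Mapping.keys y \<subseteq> S\<rbrakk>
      \<Longrightarrow> d (coset (x + y)) = d (coset x) \<oplus>\<^bsub>Q\<^esub> d (coset y)"
    and "Poly_Mapping.keys x \<subseteq> S
      \<Longrightarrow> d (coset (Poly_Mapping.single 0 c * x)) = c \<odot>\<^bsub>Q\<^esub> d (coset x)"
    and "\<lbrakk>Poly_Mapping.keys x \<subseteq> S; Poly_Mapping.keys y \<subseteq> S\<rbrakk>
      \<Longrightarrow> d (coset (x * y)) = (coset x \<otimes>\<^bsub>Q\<^esub> d (coset y)) \<oplus>\<^bsub>Q\<^esub> (d (coset x) \<otimes>\<^bsub>Q\<^esub> coset y)"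
proof -
  note d = assms[unfolded Der_def mem_Collect_eq]
  show "\<exists>p. Poly_Mapping.keys p \<subseteq> S \<and> d (coset x) = coset p" if x: "Poly_Mapping.keys x \<subseteq> S"
  proof -
    have "d (coset x) \<in> carrier Q"
      by (rule PiE_mem[OF conjunct1[OF d] coset_in_Q[OF x]])
    then show ?thesis by (rule Q_cases) (intro exI conjI)
  qed
  show "d (coset (x + y)) = d (coset x) \<oplus>\<^bsub>Q\<^esub> d (coset y)"
    if x: "Poly_Mapping.keys x \<subseteq> S" and y: "Poly_Mapping.keys y \<subseteq> S"
    using conjunct1[OF conjunct2[OF d], rule_format, OF coset_in_Q[OF x] coset_in_Q[OF y]]
    by (simp only: plus_Q[OF x y])
  show "d (coset (Poly_Mapping.single 0 c * x)) = c \<odot>\<^bsub>Q\<^esub> d (coset x)"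
    if x: "Poly_Mapping.keys x \<subseteq> S"
    using conjunct1[OF conjunct2[OF conjunct2[OF d]], rule_format, OF coset_in_Q[OF x], of c]
    by (simp only: smult_Q[OF x])
  show "d (coset (x * y)) = (coset x \<otimes>\<^bsub>Q\<^esub> d (coset y)) \<oplus>\<^bsub>Q\<^esub> (d (coset x) \<otimes>\<^bsub>Q\<^esub> coset y)"
    if x: "Poly_Mapping.keys x \<subseteq> S" and y: "Poly_Mapping.keys y \<subseteq> S"
    using conjunct2[OF conjunct2[OF conjunct2[OF d]], rule_format, OF coset_in_Q[OF x] coset_in_Q[OF y]]
    by (simp only: times_Q[OF x y])
qed

locale free_semigroup = additive_submonoid S for S :: "'m::ab_group_add set" +
  fixes F :: "'m set" and c :: "'m \<Rightarrow> 'm \<Rightarrow> nat"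
  assumes basis: "free_basis S F c"
begin

lemma finite_F: "finite F" and gen_F: "generates S F"
  using basis by (simp_all add: free_basis_def)

lemma F_subset: "b \<in> F \<Longrightarrow> b \<in> S"
  using gen_F by (auto simp: generates_def)

lemma c_add: "\<lbrakk>b \<in> F; s \<in> S; t \<in> S\<rbrakk> \<Longrightarrow> c b (s + t) = c b s + c b t"
  using basis by (simp add: free_basis_def)

lemma c_gen: "\<lbrakk>b \<in> F; g \<in> F\<rbrakk> \<Longrightarrow> c b g = of_bool (g = b)"
  using basis by (simp add: free_basis_def)

lemma c_zero: "b \<in> F \<Longrightarrow> c b 0 = 0"
  using c_add[of b 0 0] zero_mem by simp

lemma diff_mem:
  assumes b: "b \<in> F" and s: "s \<in> S" "c b s \<noteq> 0" shows "s - b \<in> S"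
proof -
  have "c b s \<noteq> 0 \<longrightarrow> s - b \<in> S"
    using gen_F s(1)
  proof (induction rule: generates_induct)
    case zero
    then show ?case by (simp add: c_zero b)
  next
    case (gen g)
    then show ?case by (simp add: c_gen b zero_mem)
  next
    case (add x y)
    show ?case
    proof (intro impI)
      assume "c b (x + y) \<noteq> 0"
      then consider "c b x \<noteq> 0" | "c b y \<noteq> 0"
        using c_add[OF b add(1,2)] by linarith
      then show "x + y - b \<in> S"
      proof cases
        case 1
        then have "(x - b) + y \<in> S" using add by (intro add_mem) simp_all
        then show ?thesis by (simp add: algebra_simps)
      next
        case 2
        then have "x + (y - b) \<in> S" using add by (intro add_mem) simp_all
        then show ?thesis by (simp add: algebra_simps)
      qed
    qed
  qed
  then show ?thesis using s(2) by simp
qed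

text \<open>
  In the polynomial ring with variables \<open>x\<^sub>b\<close>, \<open>b \<in> F\<close>, this is \<open>\<Sum>\<^sub>b f\<^sub>b \<partial>x\<^sup>s/\<partial>x\<^sub>b\<close>. The exponent \<open>s - b\<close>
  is formed in the ambient group; where it lies outside \<open>S\<close>, the multiplicity \<open>c b s\<close> is \<open>0\<close> and
  the term vanishes.
\<close>

definition monomial_derivative :: "('m \<Rightarrow> 'm \<Rightarrow>\<^sub>0 'k::field) \<Rightarrow> 'm \<Rightarrow> 'm \<Rightarrow>\<^sub>0 'k" where
  "monomial_derivative f s = (\<Sum>b\<in>F. Poly_Mapping.single (s - b) (of_nat (c b s)) * f b)"

definition derivative :: "('m \<Rightarrow> 'm \<Rightarrow>\<^sub>0 'k::field) \<Rightarrow> ('m \<Rightarrow>\<^sub>0 'k) \<Rightarrow> 'm \<Rightarrow>\<^sub>0 'k" where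
  "derivative f x = (\<Sum>s\<in>Poly_Mapping.keys x.
     Poly_Mapping.single 0 (Poly_Mapping.lookup x s) * monomial_derivative f s)"

lemma monomial_derivative_zero: "monomial_derivative f 0 = 0"
  by (simp add: monomial_derivative_def c_zero)

lemma monomial_derivative_gen: "b \<in> F \<Longrightarrow> monomial_derivative f b = f b"
  by (simp add: monomial_derivative_def c_gen sum.remove[OF finite_F, of b])
    (rule sum.neutral, auto)

lemma monomial_derivative_add:
  assumes "s \<in> S" "t \<in> S"
  shows "monomial_derivative f (s + t)
    = Poly_Mapping.single s 1 * monomial_derivative f t + Poly_Mapping.single t 1 * monomial_derivative f s"
proof -
  have "Poly_Mapping.single (s + t - b) (of_nat (c b (s + t))) * f b
      = Poly_Mapping.single s 1 * (Poly_Mapping.single (t - b) (of_nat (c b t)) * f b)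
        + Poly_Mapping.single t 1 * (Poly_Mapping.single (s - b) (of_nat (c b s)) * f b)"
    if "b \<in> F" for b
  proof -
    have 1: "s + (t - b) = s + t - b" and 2: "t + (s - b) = s + t - b"
      by (simp_all add: algebra_simps)
    show ?thesis
      by (simp add: c_add[OF that assms] mult.assoc[symmetric] mult_single 1 2 single_add algebra_simps)
  qed
  then show ?thesis
    by (simp add: monomial_derivative_def sum.distrib sum_distrib_left)
qed

lemma derivative_single:
  "derivative f (Poly_Mapping.single s a) = Poly_Mapping.single 0 a * monomial_derivative f s"
  by (simp add: derivative_def)

lemma derivative_zero: "derivative f 0 = 0"
  by (simp add: derivative_def)

lemma derivative_add: "derivative f (x + y) = derivative f x + derivative f y"
  unfolding derivative_def by (rule linear_extension_add)

lemma derivative_mult: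
  fixes f :: "'m \<Rightarrow> 'm \<Rightarrow>\<^sub>0 'k::field"
  assumes x: "Poly_Mapping.keys x \<subseteq> S" and y: "Poly_Mapping.keys y \<subseteq> S"
  shows "derivative f (x * y) = x * derivative f y + derivative f x * y"
  using x
proof (induction rule: poly_mapping_single_induct)
  case zero
  then show ?case by (simp add: derivative_zero)
next
  case (single s a)
  show ?case
    using y
  proof (induction rule: poly_mapping_single_induct)
    case zero
    then show ?case by (simp add: derivative_zero)
  next
    case (single t d)
    have 1: "Poly_Mapping.single 0 (a * d) * (Poly_Mapping.single s 1 * p)
        = Poly_Mapping.single s a * (Poly_Mapping.single 0 d * p)" for p :: "'m \<Rightarrow>\<^sub>0 'k"
      by (simp add: mult.assoc[symmetric] mult_single)
    have 2: "Poly_Mapping.single 0 (a * d) * (Poly_Mapping.single t 1 * p)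
        = Poly_Mapping.single 0 a * p * Poly_Mapping.single t d" for p :: "'m \<Rightarrow>\<^sub>0 'k"
    proof -
      have "Poly_Mapping.single 0 a * p * Poly_Mapping.single t d
          = (Poly_Mapping.single 0 a * Poly_Mapping.single t d) * p"
        by (simp only: mult_ac)
      then show ?thesis by (simp add: mult.assoc[symmetric] mult_single)
    qed
    show ?case
      unfolding mult_single derivative_single monomial_derivative_add[OF \<open>s \<in> S\<close> \<open>t \<in> S\<close>]
        distrib_left 1 2 ..
  next
    case (add y z)
    then show ?case by (simp add: derivative_add algebra_simps)
  qed
next
  case (add x z)
  then show ?case by (simp add: derivative_add algebra_simps)
qed

lemma derivative_scale:
  assumes "Poly_Mapping.keys x \<subseteq> S"
  shows "derivative f (Poly_Mapping.single 0 a * x) = Poly_Mapping.single 0 a * derivative f x"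
proof -
  have "Poly_Mapping.keys (Poly_Mapping.single 0 a) \<subseteq> S" using zero_mem by simp
  then show ?thesis
    using derivative_mult[OF _ assms, of "Poly_Mapping.single 0 a" f]
    by (simp add: derivative_single monomial_derivative_zero)
qed

context
  fixes f :: "'m \<Rightarrow> 'm \<Rightarrow>\<^sub>0 'k::field"
  assumes f: "\<And>b. b \<in> F \<Longrightarrow> Poly_Mapping.keys (f b) \<subseteq> S"
begin

lemma keys_monomial_derivative:
  assumes "s \<in> S" shows "Poly_Mapping.keys (monomial_derivative f s) \<subseteq> S"
proof -
  have "Poly_Mapping.keys (Poly_Mapping.single (s - b) (of_nat (c b s)) * f b) \<subseteq> S" if "b \<in> F" for b
    by (intro keys_times_subset f that) (cases "c b s = 0"; simp add: diff_mem[OF that assms])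
  then show ?thesis
    unfolding monomial_derivative_def by (intro order_trans[OF keys_sum] UN_least)
qed

lemma keys_derivative:
  assumes "Poly_Mapping.keys x \<subseteq> S" shows "Poly_Mapping.keys (derivative f x) \<subseteq> S"
  unfolding derivative_def
  by (intro order_trans[OF keys_sum] UN_least order_trans[OF keys_single_times]
      keys_monomial_derivative subsetD[OF assms])

lemma derivative_in_Der:
  "restrict (derivative f) {p. Poly_Mapping.keys p \<subseteq> S}
    \<in> Der (semigroup_algebra S :: ('k, 'm \<Rightarrow>\<^sub>0 'k) module)"
  unfolding Der_def semigroup_algebra_simps
proof (intro CollectI conjI ballI allI)
  show "restrict (derivative f) {p. Poly_Mapping.keys p \<subseteq> S}
    \<in> {p. Poly_Mapping.keys p \<subseteq> S} \<rightarrow>\<^sub>E {p. Poly_Mapping.keys p \<subseteq> S}"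
    by (rule PiE_I) (simp_all add: keys_derivative)
  fix x y :: "'m \<Rightarrow>\<^sub>0 'k" and a
  assume x: "x \<in> {p. Poly_Mapping.keys p \<subseteq> S}"
  have ax: "Poly_Mapping.keys (Poly_Mapping.single 0 a * x) \<subseteq> S"
    using order_trans[OF keys_single_times] x by simp
  show "restrict (derivative f) {p. Poly_Mapping.keys p \<subseteq> S} (Poly_Mapping.single 0 a * x)
      = Poly_Mapping.single 0 a * restrict (derivative f) {p. Poly_Mapping.keys p \<subseteq> S} x"
    using x ax by (simp add: derivative_scale)
  assume y: "y \<in> {p. Poly_Mapping.keys p \<subseteq> S}"
  show "restrict (derivative f) {p. Poly_Mapping.keys p \<subseteq> S} (x + y)
      = restrict (derivative f) {p. Poly_Mapping.keys p \<subseteq> S} x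
        + restrict (derivative f) {p. Poly_Mapping.keys p \<subseteq> S} y"
    using x y by (simp add: keys_plus_subset derivative_add)
  show "restrict (derivative f) {p. Poly_Mapping.keys p \<subseteq> S} (x * y)
      = x * restrict (derivative f) {p. Poly_Mapping.keys p \<subseteq> S} y
        + restrict (derivative f) {p. Poly_Mapping.keys p \<subseteq> S} x * y"
    using x y by (simp add: keys_times_subset derivative_mult)
qed

end

text \<open>
  Lifts \<open>f\<^sub>b\<close> of the images of the generators determine a derivation of \<open>k[S]\<close>, because there are no
  relations to respect. Modulo \<open>I\<close> it agrees with the given derivation on the generators, hence
  everywhere; in particular it preserves \<open>I\<close>.
\<close>

lemma quotient_derivation_lifts:
  assumes "semigroup_algebra_ideal S (I :: ('m \<Rightarrow>\<^sub>0 'k::field) set)"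
    and d: "d \<in> Der (quotient_algebra (semigroup_algebra S :: ('k, 'm \<Rightarrow>\<^sub>0 'k) module) I)"
  shows "d \<in> induced_map (semigroup_algebra S) I ` Der_ideal (semigroup_algebra S) I"
proof -
  interpret semigroup_algebra_ideal S I by (rule assms(1))
  let ?X = "\<lambda>s. Poly_Mapping.single s 1 :: 'm \<Rightarrow>\<^sub>0 'k"
  note dQ = DerQ_D[OF d]
  have keys_X: "Poly_Mapping.keys (?X s) \<subseteq> S" if "s \<in> S" for s
    using that by simp
  have "\<forall>b\<in>F. \<exists>p. Poly_Mapping.keys p \<subseteq> S \<and> d (coset (?X b)) = coset p"
    by (intro ballI dQ(1) keys_X F_subset)
  then obtain f where f: "\<forall>b\<in>F. Poly_Mapping.keys (f b) \<subseteq> S \<and> d (coset (?X b)) = coset (f b)"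
    by (rule bchoice[THEN exE])
  have f_keys: "Poly_Mapping.keys (f b) \<subseteq> S" and f_eq: "d (coset (?X b)) = coset (f b)" if "b \<in> F" for b
    using f that by simp_all
  have const: "d (coset 0) = coset 0"
  proof -
    obtain p where p: "Poly_Mapping.keys p \<subseteq> S" "d (coset 0) = coset p"
      using dQ(1)[of 0] by auto
    have "d (coset (Poly_Mapping.single 0 0 * 0)) = 0 \<odot>\<^bsub>Q\<^esub> coset p"
      using dQ(3)[of 0 0] p(2) by simp
    then show ?thesis by (simp add: smult_Q[OF p(1)])
  qed
  have one: "d (coset 1) = coset 0"
  proof -
    have keys1: "Poly_Mapping.keys (1 :: 'm \<Rightarrow>\<^sub>0 'k) \<subseteq> S" using zero_mem by simp
    obtain p where p: "Poly_Mapping.keys p \<subseteq> S" "d (coset 1) = coset p"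
      using dQ(1)[OF keys1] by (elim exE conjE)
    have "coset p = coset (p + p)"
      using dQ(4)[OF keys1 keys1] p(2)
      by (simp add: times_Q[OF keys1 p(1)] times_Q[OF p(1) keys1] plus_Q[OF p(1) p(1)])
    then have "p - (p + p) \<in> I"
      using coset_eq_iff[OF p(1) keys_plus_subset[OF p(1) p(1)]] by simp
    then have "p \<in> I"
      using I_uminus[of "p - (p + p)"] by simp
    then show ?thesis
      using coset_eq_iff[OF p(1), of 0] p(2) by simp
  qed
  have mono: "d (coset (?X s)) = coset (monomial_derivative f s)" if "s \<in> S" for s
    using gen_F that
  proof (induction rule: generates_induct)
    case zero
    then show ?case by (simp add: one monomial_derivative_zero)
  next
    case (gen g)
    then show ?case by (simp only: f_eq monomial_derivative_gen)
  next
    case (add s t)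
    note Ds = keys_monomial_derivative[OF f_keys add(1)] and Dt = keys_monomial_derivative[OF f_keys add(2)]
    note Xs = keys_X[OF add(1)] and Xt = keys_X[OF add(2)]
    have "?X (s + t) = ?X s * ?X t" by (simp add: mult_single)
    then have "d (coset (?X (s + t)))
        = (coset (?X s) \<otimes>\<^bsub>Q\<^esub> coset (monomial_derivative f t))
          \<oplus>\<^bsub>Q\<^esub> (coset (monomial_derivative f s) \<otimes>\<^bsub>Q\<^esub> coset (?X t))"
      by (simp only: dQ(4)[OF Xs Xt] add(3,4))
    also have "\<dots> = coset (?X s * monomial_derivative f t + monomial_derivative f s * ?X t)"
      by (simp only: times_Q[OF Xs Dt] times_Q[OF Ds Xt]
          plus_Q[OF keys_times_subset[OF Xs Dt] keys_times_subset[OF Ds Xt]])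
    finally show ?case
      unfolding monomial_derivative_add[OF add(1,2)] by (simp only: mult.commute)
  qed
  have lift: "d (coset x) = coset (derivative f x)" if "Poly_Mapping.keys x \<subseteq> S" for x
    using that
  proof (induction rule: poly_mapping_single_induct)
    case zero
    then show ?case by (simp add: const derivative_zero)
  next
    case (single s a)
    have "Poly_Mapping.single s a = Poly_Mapping.single 0 a * ?X s" by (simp add: mult_single)
    then show ?case
      by (simp only: dQ(3)[OF keys_X[OF single]] mono[OF single] derivative_scale[OF keys_X[OF single]]
          smult_Q[OF keys_monomial_derivative[OF f_keys single]])
        (simp add: derivative_single)
  next
    case (add x y)
    then show ?case
      by (simp only: dQ(2) derivative_add plus_Q keys_derivative[OF f_keys])
  qed
  let ?\<delta> = "restrict (derivative f) {p. Poly_Mapping.keys p \<subseteq> S}"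
  have \<delta>: "?\<delta> \<in> Der B" by (rule derivative_in_Der[OF f_keys])
  have d_eq: "d (coset x) = coset (?\<delta> x)" if "Poly_Mapping.keys x \<subseteq> S" for x
    using lift[OF that] that by simp
  show ?thesis
  proof (rule image_eqI)
    show "d = induced_map B I ?\<delta>"
      by (rule sym) (rule lift_of_quotient_derivation(2)[OF \<delta> d d_eq])
    show "?\<delta> \<in> Der_ideal B I"
      by (rule lift_of_quotient_derivation(1)[OF \<delta> d d_eq])
  qed
qed

end

section \<open>Rank and coordinates\<close>

lemma group_add_monoid: "group (add_monoid_on (UNIV :: 'm::ab_group_add set))"
proof (rule groupI)
  fix x :: 'm
  show "\<exists>y\<in>carrier (add_monoid_on UNIV). y \<otimes>\<^bsub>add_monoid_on UNIV\<^esub> x = \<one>\<^bsub>add_monoid_on UNIV\<^esub>"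
    by (rule bexI[of _ "- x"]) (simp_all add: add_monoid_on_def)
qed (simp_all add: add_monoid_on_def add.assoc)

lemma minimally_embedded_subgroup:
  fixes L :: "'m::ab_group_add set"
  assumes S: "minimally_embedded S" "S \<subseteq> L"
    and L: "0 \<in> L" "\<And>x y. \<lbrakk>x \<in> L; y \<in> L\<rbrakk> \<Longrightarrow> x - y \<in> L"
  shows "L = UNIV"
proof -
  interpret group "add_monoid_on (UNIV :: 'm set)" by (rule group_add_monoid)
  have uminus: "- x \<in> L" if "x \<in> L" for x
    using L(2)[OF L(1) that] by simp
  have "subgroup L (add_monoid_on UNIV)"
  proof (rule subgroupI)
    show "L \<noteq> {}" using L(1) by blast
    fix a b assume a: "a \<in> L"
    have "inv\<^bsub>add_monoid_on UNIV\<^esub> a = - a"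
      by (rule inv_equality) (simp_all add: add_monoid_on_def)
    then show "inv\<^bsub>add_monoid_on UNIV\<^esub> a \<in> L" using uminus[OF a] by simp
    assume "b \<in> L"
    then show "a \<otimes>\<^bsub>add_monoid_on UNIV\<^esub> b \<in> L"
      using L(2)[OF a uminus[of b]] by (simp add: add_monoid_on_def)
  qed (simp add: add_monoid_on_def)
  then show ?thesis using S by (simp add: minimally_embedded_def)
qed

text \<open>
  Homomorphisms to \<open>\<int>/2\<close>, represented by the sets of elements with odd image. A free abelian group
  with a basis of size \<open>r\<close> has exactly \<open>2\<^sup>r\<close> of them, so counting them shows that all finite bases
  have the same size.
\<close>

definition parity_sets :: "'m::ab_group_add set set" where
  "parity_sets = {P. \<forall>x y. x + y \<in> P \<longleftrightarrow> (x \<in> P) \<noteq> (y \<in> P)}"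

text \<open>
  A homomorphism to \<open>\<int>/2\<close> is determined by its values on a basis, and these values are arbitrary:
  the coordinate functions realise any choice of them.
\<close>

lemma card_parity_sets:
  fixes F :: "'m::ab_group_add set" and c :: "'m \<Rightarrow> 'm \<Rightarrow> int"
  assumes fin: "finite F"
    and gen: "\<And>L. \<lbrakk>0 \<in> L; \<And>x y. \<lbrakk>x \<in> L; y \<in> L\<rbrakk> \<Longrightarrow> x - y \<in> L; F \<subseteq> L\<rbrakk> \<Longrightarrow> L = UNIV"
    and add: "\<And>b x y. b \<in> F \<Longrightarrow> c b (x + y) = c b x + c b y"
    and dual: "\<And>b g. \<lbrakk>b \<in> F; g \<in> F\<rbrakk> \<Longrightarrow> c b g = of_bool (g = b)"
  shows "card (parity_sets :: 'm set set) = 2 ^ card F"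
proof -
  have "bij_betw (\<lambda>P. P \<inter> F) parity_sets (Pow F)"
  proof (rule bij_betw_imageI)
    show "inj_on (\<lambda>P. P \<inter> F) (parity_sets :: 'm set set)"
    proof (rule inj_onI)
      fix P R :: "'m set"
      assume "P \<in> parity_sets" "R \<in> parity_sets" and eq: "P \<inter> F = R \<inter> F"
      then have P: "\<And>x y. x + y \<in> P \<longleftrightarrow> (x \<in> P) \<noteq> (y \<in> P)"
        and R: "\<And>x y. x + y \<in> R \<longleftrightarrow> (x \<in> R) \<noteq> (y \<in> R)"
        by (simp_all add: parity_sets_def)
      have "{m. m \<in> P \<longleftrightarrow> m \<in> R} = UNIV"
      proof (rule gen)
        show "0 \<in> {m. m \<in> P \<longleftrightarrow> m \<in> R}" using P[of 0 0] R[of 0 0] by simp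
        show "F \<subseteq> {m. m \<in> P \<longleftrightarrow> m \<in> R}" using eq by blast
        fix x y assume "x \<in> {m. m \<in> P \<longleftrightarrow> m \<in> R}" "y \<in> {m. m \<in> P \<longleftrightarrow> m \<in> R}"
        then show "x - y \<in> {m. m \<in> P \<longleftrightarrow> m \<in> R}"
          using P[of "x - y" y] R[of "x - y" y] by auto
      qed
      then show "P = R" by blast
    qed
    have "Pow F \<subseteq> (\<lambda>P. P \<inter> F) ` parity_sets"
    proof
      fix T assume "T \<in> Pow F"
      then have T: "T \<subseteq> F" by simp
      let ?P = "{m. odd (\<Sum>b\<in>T. c b m)}"
      have "(\<Sum>b\<in>T. c b (x + y)) = (\<Sum>b\<in>T. c b x) + (\<Sum>b\<in>T. c b y)" for x y
        unfolding sum.distrib[symmetric] using T add by (intro sum.cong) auto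
      then have "?P \<in> parity_sets" by (auto simp: parity_sets_def)
      moreover have "?P \<inter> F = T"
      proof -
        have "(\<Sum>b\<in>T. c b g) = of_bool (g \<in> T)" if "g \<in> F" for g
        proof -
          have "(\<Sum>b\<in>T. c b g) = (\<Sum>b\<in>T. if g = b then 1 else 0)"
            using T dual that by (intro sum.cong) auto
          then show ?thesis using finite_subset[OF T fin] by simp
        qed
        then show ?thesis using T by auto
      qed
      ultimately show "T \<in> (\<lambda>P. P \<inter> F) ` parity_sets" by (intro image_eqI[of _ _ ?P]) simp_all
    qed
    then show "(\<lambda>P. P \<inter> F) ` parity_sets = Pow F" by blast
  qed
  then show ?thesis
    using bij_betw_same_card card_Pow[OF fin] by metis
qed

locale lattice_coordinates =
  fixes h :: "'m::ab_group_add \<Rightarrow> (nat \<Rightarrow>\<^sub>0 int)" and n :: nat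
  assumes h: "h \<in> iso (add_monoid_on UNIV) (free_Abelian_group {..<n})"
begin

lemma h_add: "h (x + y) = h x + h y"
  using h by (simp add: iso_def hom_def add_monoid_on_def)

lemma h_zero: "h 0 = 0"
  using h_add[of 0 0] by simp

lemma h_minus: "h (x - y) = h x - h y"
  using h_add[of "x - y" y] by (simp add: algebra_simps)

lemma h_bij: "bij_betw h UNIV {v. Poly_Mapping.keys v \<subseteq> {..<n}}"
proof -
  have "carrier (free_Abelian_group {..<n}) = {v. Poly_Mapping.keys v \<subseteq> {..<n}}" by auto
  then show ?thesis
    using h by (simp add: iso_def add_monoid_on_def)
qed

lemma h_inj: "h x = h y \<Longrightarrow> x = y"
  using h_bij by (simp add: bij_betw_def inj_on_def)

lemma h_surj: "Poly_Mapping.keys v \<subseteq> {..<n} \<Longrightarrow> \<exists>x. h x = v"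
  using bij_betw_imp_surj_on[OF h_bij] by (metis imageE mem_Collect_eq)

lemma card_parity_sets_rank: "card (parity_sets :: 'm set set) = 2 ^ n"
proof -
  have "\<forall>i\<in>{..<n}. \<exists>x. h x = frag_of i"
    by (intro ballI h_surj) simp
  then obtain e where e: "\<forall>i\<in>{..<n}. h (e i) = frag_of i" by (rule bchoice[THEN exE])
  have inj: "inj_on e {..<n}"
    by (rule inj_onI) (metis e frag_of_eq)
  have "card (parity_sets :: 'm set set) = 2 ^ card (e ` {..<n})"
  proof (rule card_parity_sets[where c = "\<lambda>b m. Poly_Mapping.lookup (h m) (inv_into {..<n} e b)"])
    fix L :: "'m set"
    assume L: "0 \<in> L" "\<And>x y. \<lbrakk>x \<in> L; y \<in> L\<rbrakk> \<Longrightarrow> x - y \<in> L" "e ` {..<n} \<subseteq> L"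
    have "\<exists>y\<in>L. h y = v" if "Poly_Mapping.keys v \<subseteq> {..<n}" for v
      using that
    proof (induction rule: frag_induction)
      case zero
      then show ?case using L(1) h_zero by blast
    next
      case (one i)
      then show ?case using L(3) e by blast
    next
      case (diff a b)
      then obtain x y where "x \<in> L" "h x = a" "y \<in> L" "h y = b" by blast
      then show ?case using L(2) h_minus by (intro bexI[of _ "x - y"]) simp_all
    qed
    moreover have "Poly_Mapping.keys (h x) \<subseteq> {..<n}" for x
      using bij_betw_apply[OF h_bij, of x] by simp
    ultimately have "x \<in> L" for x
      using h_inj by metis
    then show "L = UNIV" by blast
  next
    fix b g assume "b \<in> e ` {..<n}" "g \<in> e ` {..<n}"
    then obtain i j where "i < n" "b = e i" "j < n" "g = e j" by auto
    then show "Poly_Mapping.lookup (h g) (inv_into {..<n} e b) = of_bool (g = b)"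
      using e inj by (auto simp: inv_into_f_f lookup_single when_def inj_on_def)
  qed (simp_all add: h_add lookup_add)
  then show ?thesis by (simp add: card_image[OF inj])
qed

text \<open>
  The span of an element of \<open>S\<close> whose negative also lies in \<open>S\<close> is a subspace inside the cone.
\<close>

lemma pointed_imp_positive:
  assumes "pointed h S" and xy: "x \<in> S" "y \<in> S" "x + y = 0"
  shows "x = 0"
proof -
  let ?r = "real_point h"
  have y: "?r y = - ?r x"
  proof -
    have "h y = - h x" using h_add[of x y] xy(3) h_zero by (simp add: add_eq_0_iff)
    then show ?thesis
      by (intro poly_mapping_eqI) (simp add: real_point_def Poly_Mapping.map.rep_eq when_def)
  qed
  have "c *\<^sub>R ?r x \<in> spanned_cone h S" for c
  proof (cases "0 \<le> c")
    case True
    then show ?thesis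
      unfolding spanned_cone_def using xy(1) by (intro convex_cone_hull_mul hull_inc imageI)
  next
    case False
    have "(- c) *\<^sub>R ?r y \<in> spanned_cone h S"
      unfolding spanned_cone_def using xy(2) False by (intro convex_cone_hull_mul hull_inc imageI) simp_all
    then show ?thesis by (simp add: y)
  qed
  then have "span {?r x} \<subseteq> spanned_cone h S"
    by (auto simp: span_singleton)
  then have "span {?r x} = {0}"
    using assms(1) subspace_span unfolding pointed_def by blast
  then have "?r x = 0"
    using span_base[of "?r x" "{?r x}"] by simp
  have "h x = 0"
  proof (rule poly_mapping_eqI)
    fix k
    have "Poly_Mapping.lookup (?r x) k = 0" using \<open>?r x = 0\<close> by simp
    then show "Poly_Mapping.lookup (h x) k = Poly_Mapping.lookup 0 k"
      by (simp add: real_point_def Poly_Mapping.map.rep_eq when_def split: if_splits)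
  qed
  then show ?thesis using h_inj[of x 0] h_zero by simp
qed

end

context additive_submonoid
begin

lemma sum_mem: "(\<And>a. a \<in> A \<Longrightarrow> g a \<in> S) \<Longrightarrow> sum g A \<in> S"
  by (induction A rule: infinite_finite_induct) (auto intro: zero_mem add_mem)

lemma additive_sum:
  fixes f :: "'m \<Rightarrow> 'b::comm_monoid_add"
  assumes "f 0 = 0" and "\<And>s t. \<lbrakk>s \<in> S; t \<in> S\<rbrakk> \<Longrightarrow> f (s + t) = f s + f t"
    and "\<And>a. a \<in> A \<Longrightarrow> g a \<in> S"
  shows "f (sum g A) = (\<Sum>a\<in>A. f (g a))"
  using assms(3)
  by (induction A rule: infinite_finite_induct) (auto simp: assms(1,2) sum_mem)

end

context free_semigroup
begin

lemma sum_multiplicities: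
  assumes "s \<in> S" shows "s = (\<Sum>b\<in>F. \<Sum>_<c b s. b)"
  using gen_F assms
proof (induction rule: generates_induct)
  case zero
  then show ?case by (simp add: c_zero)
next
  case (gen g)
  have "(\<Sum>b\<in>F. \<Sum>_<c b g. b) = (\<Sum>b\<in>F. if b = g then b else 0)"
    using gen by (intro sum.cong) (auto simp: c_gen)
  then show ?case using gen finite_F by simp
next
  case (add x y)
  have split: "(\<Sum>_<k + l. b) = (\<Sum>_<k. b) + (\<Sum>_<l. b)" for k l :: nat and b :: 'm
    by (induction l) (simp_all add: add.assoc)
  have "(\<Sum>b\<in>F. \<Sum>_<c b (x + y). b) = (\<Sum>b\<in>F. \<Sum>_<c b x. b) + (\<Sum>b\<in>F. \<Sum>_<c b y. b)"
    unfolding sum.distrib[symmetric] split[symmetric]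
    using add(1,2) by (intro sum.cong) (simp_all add: c_add)
  then show ?case using add(3,4) by simp
qed

text \<open>
  Since \<open>S\<close> generates \<open>M\<close>, each element of \<open>M\<close> is a difference of elements of \<open>S\<close>, and the
  multiplicities extend to integer coordinates on \<open>M\<close>.
\<close>

lemma integer_coordinate:
  assumes M: "minimally_embedded S" and b: "b \<in> F"
  shows "\<exists>g :: 'm \<Rightarrow> int. (\<forall>x y. g (x + y) = g x + g y) \<and> (\<forall>s\<in>S. g s = int (c b s))"
proof -
  have "{s - t | s t. s \<in> S \<and> t \<in> S} = UNIV"
  proof (rule minimally_embedded_subgroup[OF M])
    show "S \<subseteq> {s - t | s t. s \<in> S \<and> t \<in> S}" using zero_mem by force
    show "0 \<in> {s - t | s t. s \<in> S \<and> t \<in> S}" using zero_mem by force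
    fix x y assume "x \<in> {s - t | s t. s \<in> S \<and> t \<in> S}" "y \<in> {s - t | s t. s \<in> S \<and> t \<in> S}"
    then obtain s t s' t' where "x = s - t" "y = s' - t'" "s \<in> S" "t \<in> S" "s' \<in> S" "t' \<in> S" by blast
    then show "x - y \<in> {s - t | s t. s \<in> S \<and> t \<in> S}"
      by (intro CollectI exI[of _ "s + t'"] exI[of _ "t + s'"]) (simp add: add_mem algebra_simps)
  qed
  then have "\<forall>x. \<exists>p. x = fst p - snd p \<and> fst p \<in> S \<and> snd p \<in> S"
    by force
  then obtain p where p: "\<And>x. x = fst (p x) - snd (p x) \<and> fst (p x) \<in> S \<and> snd (p x) \<in> S"
    by metis
  define g where "g x = int (c b (fst (p x))) - int (c b (snd (p x)))" for x
  have g: "g (s - t) = int (c b s) - int (c b t)" if st: "s \<in> S" "t \<in> S" for s t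
  proof -
    let ?u = "fst (p (s - t))" and ?v = "snd (p (s - t))"
    have uv: "?u \<in> S" "?v \<in> S" and "s - t = ?u - ?v"
      using p[of "s - t"] by simp_all
    then have "?u + t = s + ?v" by (simp add: algebra_simps)
    then have "c b ?u + c b t = c b s + c b ?v"
      using c_add[OF b uv(1) st(2)] c_add[OF b st(1) uv(2)] by simp
    then show ?thesis unfolding g_def by linarith
  qed
  have "g (x + y) = g x + g y" for x y
  proof -
    define s t s' t' where "s = fst (p x)" and "t = snd (p x)" and "s' = fst (p y)" and "t' = snd (p y)"
    have S: "s \<in> S" "t \<in> S" "s' \<in> S" "t' \<in> S" and x: "x = s - t" and y: "y = s' - t'"
      using p[of x] p[of y] by (simp_all add: s_def t_def s'_def t'_def)
    have "x + y = (s + s') - (t + t')" using x y by simp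
    then have "g (x + y) = int (c b (s + s')) - int (c b (t + t'))"
      using g[of "s + s'" "t + t'"] S add_mem by simp
    then show ?thesis
      using g[OF S(1,2)] g[OF S(3,4)] x y c_add[OF b] S by simp
  qed
  moreover have "g s = int (c b s)" if "s \<in> S" for s
    using g[OF that zero_mem] c_zero[OF b] by simp
  ultimately show ?thesis by (intro exI[of _ g]) simp
qed

lemma card_parity_sets_basis:
  assumes M: "minimally_embedded S"
  shows "card (parity_sets :: 'm set set) = 2 ^ card F"
proof -
  have "\<forall>b\<in>F. \<exists>g :: 'm \<Rightarrow> int. (\<forall>x y. g (x + y) = g x + g y) \<and> (\<forall>s\<in>S. g s = int (c b s))"
    by (intro ballI integer_coordinate M)
  then obtain g :: "'m \<Rightarrow> 'm \<Rightarrow> int"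
    where g: "\<forall>b\<in>F. (\<forall>x y. g b (x + y) = g b x + g b y) \<and> (\<forall>s\<in>S. g b s = int (c b s))"
    by (rule bchoice[THEN exE])
  show ?thesis
  proof (rule card_parity_sets[OF finite_F, where c = g])
    fix L :: "'m set"
    assume L: "0 \<in> L" "\<And>x y. \<lbrakk>x \<in> L; y \<in> L\<rbrakk> \<Longrightarrow> x - y \<in> L" "F \<subseteq> L"
    have "S \<subseteq> L"
    proof (rule generatesD[OF gen_F L(1) _ L(3)])
      fix x y assume "x \<in> L" "y \<in> L"
      then show "x + y \<in> L" using L(2)[of x "0 - y"] L(2)[OF L(1), of y] by simp
    qed
    then show "L = UNIV" by (rule minimally_embedded_subgroup[OF M _ L(1,2)])
  qed (use g c_gen F_subset in simp_all)
qed

end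

section \<open>Freeness and the orthant\<close>

lemma nonneg_orthant_iff:
  "v \<in> nonneg_orthant n \<longleftrightarrow> Poly_Mapping.keys v \<subseteq> {..<n} \<and> (\<forall>i. 0 \<le> Poly_Mapping.lookup v i)"
  by (simp add: nonneg_orthant_def)

lemma lookup_eq_0_outside:
  "\<lbrakk>Poly_Mapping.keys v \<subseteq> A; i \<notin> A\<rbrakk> \<Longrightarrow> Poly_Mapping.lookup v i = 0"
  by (auto simp: in_keys_iff)

lemma sum_unit_vectors:
  assumes "v \<in> nonneg_orthant n"
  shows "(\<Sum>i<n. \<Sum>_<nat (Poly_Mapping.lookup v i). frag_of i) = v"
proof (rule poly_mapping_eqI)
  fix k
  have "Poly_Mapping.lookup (\<Sum>i<n. \<Sum>_<nat (Poly_Mapping.lookup v i). frag_of i) k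
      = (\<Sum>i<n. if k = i then Poly_Mapping.lookup v k else 0)"
    unfolding lookup_sum
    using assms by (intro sum.cong) (auto simp: lookup_single when_def nonneg_orthant_iff)
  also have "\<dots> = Poly_Mapping.lookup v k"
    using assms lookup_eq_0_outside[of v "{..<n}" k] by (simp add: nonneg_orthant_iff)
  finally show "Poly_Mapping.lookup (\<Sum>i<n. \<Sum>_<nat (Poly_Mapping.lookup v i). frag_of i) k
      = Poly_Mapping.lookup v k" .
qed

context free_semigroup
begin

lemma iso_nonneg_orthant:
  assumes "card F = n"
  shows "add_monoid_on S \<cong> add_monoid_on (nonneg_orthant n)"
proof -
  obtain e where e: "bij_betw e {..<n} F"
    using ex_bij_betw_nat_finite[OF finite_F] assms by (auto simp: atLeast0LessThan)
  have eF: "e i \<in> F" if "i < n" for i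
    using bij_betw_apply[OF e] that by simp
  have e_eq: "e i = e j \<longleftrightarrow> i = j" if "i < n" "j < n" for i j
    using e that by (auto simp: bij_betw_def inj_on_def)
  define \<phi> :: "'m \<Rightarrow> nat \<Rightarrow>\<^sub>0 int"
    where "\<phi> s = (\<Sum>i<n. Poly_Mapping.single i (int (c (e i) s)))" for s
  have lookup: "Poly_Mapping.lookup (\<phi> s) i = (if i < n then int (c (e i) s) else 0)" for s i
    by (simp add: \<phi>_def lookup_sum lookup_single when_def)
  have orthant: "\<phi> s \<in> nonneg_orthant n" for s
    unfolding nonneg_orthant_iff by (auto simp: lookup in_keys_iff split: if_splits)
  have hom: "\<phi> (s + t) = \<phi> s + \<phi> t" if "s \<in> S" "t \<in> S" for s t
    by (rule poly_mapping_eqI) (simp add: lookup lookup_add c_add[OF eF that])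
  have "bij_betw \<phi> S (nonneg_orthant n)"
    unfolding bij_betw_def
  proof (intro conjI inj_onI subset_antisym)
    fix s t assume st: "s \<in> S" "t \<in> S" and eq: "\<phi> s = \<phi> t"
    have "c b s = c b t" if b: "b \<in> F" for b
    proof -
      obtain i where "i < n" "b = e i"
        using b bij_betw_imp_surj_on[OF e] by (metis imageE lessThan_iff)
      then show ?thesis using lookup[of s i] lookup[of t i] eq by simp
    qed
    then have "(\<Sum>b\<in>F. \<Sum>_<c b s. b) = (\<Sum>b\<in>F. \<Sum>_<c b t. b)"
      by (intro sum.cong) simp_all
    then show "s = t"
      using sum_multiplicities[OF st(1)] sum_multiplicities[OF st(2)] by simp
  next
    show "nonneg_orthant n \<subseteq> \<phi> ` S"
    proof
      fix v assume v: "v \<in> nonneg_orthant n"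
      let ?s = "\<Sum>i<n. \<Sum>_<nat (Poly_Mapping.lookup v i). e i"
      have inner: "(\<Sum>_<k. e i) \<in> S" if "i < n" for i and k :: nat
        by (rule sum_mem) (rule F_subset[OF eF[OF that]])
      have "\<phi> ?s = v"
      proof (rule poly_mapping_eqI)
        fix j
        show "Poly_Mapping.lookup (\<phi> ?s) j = Poly_Mapping.lookup v j"
        proof (cases "j < n")
          case True
          have "c (e j) ?s = (\<Sum>i<n. c (e j) (\<Sum>_<nat (Poly_Mapping.lookup v i). e i))"
            by (rule additive_sum) (use c_zero c_add eF[OF True] inner in simp_all)
          also have "\<dots> = (\<Sum>i<n. \<Sum>_<nat (Poly_Mapping.lookup v i). c (e j) (e i))"
            by (intro sum.cong refl additive_sum) (use c_zero c_add eF[OF True] F_subset eF in simp_all)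
          also have "\<dots> = (\<Sum>i<n. if j = i then nat (Poly_Mapping.lookup v j) else 0)"
            using True eF e_eq by (intro sum.cong) (auto simp: c_gen)
          also have "\<dots> = nat (Poly_Mapping.lookup v j)"
            using True by simp
          finally show ?thesis
            using True v by (simp add: lookup nonneg_orthant_iff)
        next
          case False
          then show ?thesis
            using v lookup_eq_0_outside[of v "{..<n}" j] by (simp add: lookup nonneg_orthant_iff)
        qed
      qed
      moreover have "?s \<in> S" by (rule sum_mem) (simp add: inner)
      ultimately show "v \<in> \<phi> ` S" by (intro image_eqI[of _ _ ?s]) simp_all
    qed
  qed (use orthant in auto)
  then have "\<phi> \<in> iso (add_monoid_on S) (add_monoid_on (nonneg_orthant n))"
    using hom orthant by (simp add: iso_def hom_def add_monoid_on_def)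
  then show ?thesis by (auto simp: is_iso_def)
qed

end

lemma (in additive_submonoid) free_basis_of_iso:
  assumes "add_monoid_on S \<cong> add_monoid_on (nonneg_orthant n)"
  obtains F c where "free_basis S F c"
proof -
  obtain \<psi> where "\<psi> \<in> iso (add_monoid_on S) (add_monoid_on (nonneg_orthant n))"
    using assms by (auto simp: is_iso_def)
  then have \<psi>_add: "\<And>s t. \<lbrakk>s \<in> S; t \<in> S\<rbrakk> \<Longrightarrow> \<psi> (s + t) = \<psi> s + \<psi> t"
    and bij: "bij_betw \<psi> S (nonneg_orthant n)"
    by (simp_all add: iso_def hom_def add_monoid_on_def)
  have \<psi>_zero: "\<psi> 0 = 0" using \<psi>_add[of 0 0] zero_mem by simp
  have \<psi>_mem: "\<psi> s \<in> nonneg_orthant n" if "s \<in> S" for s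
    using bij_betw_apply[OF bij that] .
  have "\<forall>i\<in>{..<n}. \<exists>s. s \<in> S \<and> \<psi> s = frag_of i"
  proof
    fix i assume "i \<in> {..<n}"
    then have "frag_of i \<in> nonneg_orthant n"
      by (simp add: nonneg_orthant_iff lookup_single when_def)
    then show "\<exists>s. s \<in> S \<and> \<psi> s = frag_of i"
      using bij_betw_imp_surj_on[OF bij] by (metis imageE)
  qed
  then obtain e where e: "\<forall>i\<in>{..<n}. e i \<in> S \<and> \<psi> (e i) = frag_of i" by (rule bchoice[THEN exE])
  have inj: "inj_on e {..<n}"
    by (rule inj_onI) (metis e frag_of_eq)
  let ?F = "e ` {..<n}"
  let ?c = "\<lambda>b s. nat (Poly_Mapping.lookup (\<psi> s) (inv_into {..<n} e b))"
  have "generates S ?F"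
    unfolding generates_def
  proof (intro conjI allI impI)
    show "?F \<subseteq> S" using e by auto
    fix N assume N: "0 \<in> N \<and> (\<forall>x\<in>N. \<forall>y\<in>N. x + y \<in> N) \<and> ?F \<subseteq> N"
    interpret N: additive_submonoid N by unfold_locales (use N in simp_all)
    show "S \<subseteq> N"
    proof
      fix s assume s: "s \<in> S"
      let ?v = "Poly_Mapping.lookup (\<psi> s)"
      let ?t = "\<Sum>i<n. \<Sum>_<nat (?v i). e i"
      have inner: "(\<Sum>_<k. e i) \<in> S" if "i < n" for i and k :: nat
        by (rule sum_mem) (use e that in simp)
      have tS: "?t \<in> S" by (rule sum_mem) (simp add: inner)
      have tN: "?t \<in> N"
        by (intro N.sum_mem) (use N in auto)
      have "\<psi> ?t = (\<Sum>i<n. \<psi> (\<Sum>_<nat (?v i). e i))"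
        by (rule additive_sum) (use \<psi>_zero \<psi>_add inner in simp_all)
      also have "\<dots> = (\<Sum>i<n. \<Sum>_<nat (?v i). \<psi> (e i))"
        by (intro sum.cong refl additive_sum) (use \<psi>_zero \<psi>_add e in simp_all)
      also have "\<dots> = (\<Sum>i<n. \<Sum>_<nat (?v i). frag_of i)"
        using e by (intro sum.cong) simp_all
      also have "\<dots> = \<psi> s" by (rule sum_unit_vectors[OF \<psi>_mem[OF s]])
      finally have "?t = s"
        using bij tS s by (simp add: bij_betw_def inj_on_def)
      then show "s \<in> N" using tN by simp
    qed
  qed
  moreover have "?c b (s + t) = ?c b s + ?c b t" if "s \<in> S" "t \<in> S" for b s t
    using \<psi>_mem[OF that(1)] \<psi>_mem[OF that(2)]
    by (simp add: \<psi>_add[OF that] lookup_add nat_add_distrib nonneg_orthant_iff)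
  moreover have "?c b g = of_bool (g = b)" if bg: "b \<in> ?F" "g \<in> ?F" for b g
  proof -
    obtain i j where "i < n" "b = e i" "j < n" "g = e j"
      using bg by auto
    then show ?thesis
      using e inj by (auto simp: inv_into_f_f lookup_single when_def inj_on_def)
  qed
  ultimately have "free_basis S ?F ?c"
    by (simp add: free_basis_def)
  then show thesis by (rule that)
qed

theorem theorem2p2:
  fixes S :: "'m::ab_group_add set"
    and n :: nat
    and h :: "'m \<Rightarrow> (nat \<Rightarrow>\<^sub>0 int)"
  assumes "h \<in> iso (add_monoid_on (UNIV :: 'm set)) (free_Abelian_group {..<n})"
    and "affine_semigroup S"
    and "minimally_embedded S"
    and "saturated h S"
    and "pointed h S"
  shows "(\<forall>I :: ('m \<Rightarrow>\<^sub>0 'k::field_char_0) set. monomial_ideal S I \<longrightarrow>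
            induced_map (semigroup_algebra S :: ('k, 'm \<Rightarrow>\<^sub>0 'k) module) I `
                Der_ideal (semigroup_algebra S) I
              = Der (quotient_algebra (semigroup_algebra S) I))
         \<longleftrightarrow> add_monoid_on S \<cong> add_monoid_on (nonneg_orthant n)"
    (is "?surjective \<longleftrightarrow> ?free")
proof -
  interpret lattice_coordinates h n by unfold_locales (rule assms(1))
  interpret additive_submonoid S
    using assms(2) by unfold_locales (simp_all add: affine_semigroup_def submonoid_add_iff)
  interpret positive_semigroup S
    by unfold_locales (rule pointed_imp_positive[OF assms(5)])
  show ?thesis
  proof
    assume surj: ?surjective
    obtain F0 where F0: "finite F0" "S = (\<lambda>T. submonoid T (add_monoid_on UNIV)) hull F0"
      using assms(2) by (auto simp: affine_semigroup_def)
    have "generates S F0"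
      unfolding generates_def
    proof (intro conjI allI impI)
      show "F0 \<subseteq> S" by (subst F0(2)) (rule hull_subset)
      fix N assume "0 \<in> N \<and> (\<forall>x\<in>N. \<forall>y\<in>N. x + y \<in> N) \<and> F0 \<subseteq> N"
      then show "S \<subseteq> N"
        by (subst F0(2)) (rule hull_minimal, simp_all add: submonoid_add_iff)
    qed
    then obtain F where F: "finite F" "generates S F" "\<And>b. b \<in> F \<Longrightarrow> \<not> generates S (F - {b})"
      using minimal_generators[OF F0(1)] by metis
    interpret irreducible_generators S F
    proof unfold_locales
      show "u = 0 \<or> v = 0" if "b \<in> F" "u \<in> S" "v \<in> S" "b = u + v" for b u v
        by (rule minimal_generator_irreducible[OF F(2) that(1) F(3)[OF that(1)] that(2-4)])
      show "0 \<notin> F"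
        using minimal_generator_nonzero[OF F(2) F(3)] by metis
    qed (rule F(1,2))+
    have "Der (quotient_algebra (semigroup_algebra S :: ('k, 'm \<Rightarrow>\<^sub>0 'k) module) square_ideal)
        \<subseteq> induced_map (semigroup_algebra S) square_ideal ` Der_ideal (semigroup_algebra S) square_ideal"
      by (rule equalityD2[OF surj[rule_format, OF monomial_ideal_square_ideal]])
    then obtain c where "free_basis S F c"
      by (rule free_basis_if_surjective)
    then interpret free_semigroup S F c by unfold_locales
    have "(2::nat) ^ card F = 2 ^ n"
      using card_parity_sets_basis[OF assms(3)] card_parity_sets_rank by simp
    then show ?free by (intro iso_nonneg_orthant) simp
  next
    assume ?free
    then obtain F c where "free_basis S F c"
      by (rule free_basis_of_iso)
    then interpret free_semigroup S F c by unfold_locales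
    show ?surjective
    proof (intro allI impI subset_antisym subsetI)
      fix I :: "('m \<Rightarrow>\<^sub>0 'k) set" and d
      assume "monomial_ideal S I"
      then obtain E where E: "E \<subseteq> S" "I = genideal (semigroup_algebra S) (monomial ` E)"
        by (auto simp: monomial_ideal_def)
      interpret R: cring "semigroup_algebra S :: ('k, 'm \<Rightarrow>\<^sub>0 'k) module"
        by (rule cring_semigroup_algebra)
      have "ideal I (semigroup_algebra S :: ('k, 'm \<Rightarrow>\<^sub>0 'k) module)"
        unfolding E(2) by (rule R.genideal_ideal) (use E(1) in \<open>auto simp: monomial_def\<close>)
      then have I: "semigroup_algebra_ideal S I"
        by (intro semigroup_algebra_ideal.intro semigroup_algebra_ideal_axioms.intro
            additive_submonoid_axioms)
      show "d \<in> Der (quotient_algebra (semigroup_algebra S) I)"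
        if "d \<in> induced_map (semigroup_algebra S) I ` Der_ideal (semigroup_algebra S) I"
        using that semigroup_algebra_ideal.induced_map_Der_ideal(1)[OF I] by (elim imageE) simp
      show "d \<in> induced_map (semigroup_algebra S) I ` Der_ideal (semigroup_algebra S) I"
        if "d \<in> Der (quotient_algebra (semigroup_algebra S) I)"
        by (rule quotient_derivation_lifts[OF I that])
    qed
  qed
qed

end
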